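(* Let $\gamma>0$ and let $L:\mathbb Z^+\to\mathcal L(\mathcal B^\gamma,\mathcal X)$. Consider the nonhomogeneous system $x(n+1)=L(n)x_n+f(n)$, $n\ge 0$, and the associated homogeneous system $x(n+1)=L(n)x_n$, $n\ge 0$. Let $(p,q)$ be such that $1\le p\le q\le\infty$ and $(p,q)\ne(1,\infty)$. Then the following statements are equivalent: (i) The homogeneous system is uniformly exponentially stable in $\mathcal X$ with respect to $\mathcal B^\gamma$. (ii) The homogeneous system is uniformly exponentially stable in $\mathcal B^\gamma$. (iii) The nonhomogeneous system is $(\ell^p,\ell^q)$-stable and there exists $m\in\mathbb Z^-$ such that $\sup_{n\in\mathbb Z^+}\|L(n)P_{[-\infty,m]}\|_{\mathcal B^\gamma\to\mathcal X}<\infty$.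
   Context: $\mathbb Z^+$ and $\mathbb Z^-$ are the sets of nonnegative and nonpositive integers. $(\mathcal X,|\cdot|)$ is a (real or complex) Banach space. $\mathcal X^{\mathbb Z^-}$ is the vector space of all tuples $\varphi=(\varphi^{[m]})_{m\le 0}$ with $\varphi^{[m]}\in\mathcal X$; its zero vector is $0_{\mathcal B}$. For $\gamma\in\mathbb R$, $\mathcal B^\gamma=\{\varphi\in\mathcal X^{\mathbb Z^-}: |\varphi|_{\mathcal B^\gamma}:=\sup_{m\le 0}|\varphi^{[m]}|e^{\gamma m}<\infty\}$ (the phase space). $\mathcal L(\mathcal B^\gamma,\mathcal X)$ is the space of bounded linear operators with operator norm $\|\cdot\|_{\mathcal B^\gamma\to\mathcal X}$. For $1\le p\le\infty$, $\ell^p(\mathcal X)$ is the usual space of $p$-summable (bounded if $p=\infty$) functions $\mathbb Z^+\to\mathcal X$. For $x:\mathbb Z\to\mathcal X$ and $n\in\mathbb Z$, the prehistory $x_n\in\mathcal X^{\mathbb Z^-}$ is defined by $x_n^{[m]}=x(n+m)$, $m\le 0$. For $\tau\in\mathbb Z^+$, $\varphi\in\mathcal B^\gamma$ and $f:\mathbb Z^+\to\mathcal X$, $x(\cdot,\tau,\varphi;f):\mathbb Z\to\mathcal X$ is the unique function $x$ with $x_\tau=\varphi$ and $x(n+1)=L(n)x_n+f(n)$ for all $n\ge\tau$; $x_n(\tau,\varphi;f)$ is its prehistory at $n$. $\mathbf 0$ denotes the zero function $f$. $P_{[-\infty,m]}:\mathcal X^{\mathbb Z^-}\to\mathcal X^{\mathbb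 Z^-}$ keeps the coordinates with index $\le m$ and replaces all other coordinates by zero. The nonhomogeneous system is $(\ell^p,\ell^q)$-stable if $x(\cdot,0,0_{\mathcal B};f)$ (restricted to $\mathbb Z^+$) belongs to $\ell^q(\mathcal X)$ for every $f\in\ell^p(\mathcal X)$. The homogeneous system is uniformly exponentially stable in $\mathcal X$ with respect to $\mathcal B^\gamma$ if there exist $K\ge1$, $\nu>0$ such that $|x(n,\tau,\varphi;\mathbf 0)|\le Ke^{-\nu(n-\tau)}|\varphi|_{\mathcal B^\gamma}$ for all $n\ge\tau\ge0$ and all $\varphi\in\mathcal B^\gamma$. It is uniformly exponentially stable in $\mathcal B^\gamma$ if the same holds with $|x(n,\tau,\varphi;\mathbf 0)|$ replaced by $|x_n(\tau,\varphi;\mathbf 0)|_{\mathcal B^\gamma}$. *)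

theory Defs
  imports "HOL-Analysis.Analysis"
begin

text \<open>
  Tuples \<open>(\<phi>\<^sup>[\<^sup>m\<^sup>])\<close> indexed by the nonpositive integers are encoded as functions
  \<open>\<phi> :: nat \<Rightarrow> 'a\<close>, where \<open>\<phi> k\<close> is the coordinate with index \<open>m = - k\<close>.
  The nonnegative integers are the type \<open>nat\<close>.

  The state space is a type of class \<open>banach\<close>, i.e. a real Banach space. A complex Banach space is
  an instance by restriction of scalars: complex-linear bounded operators are real-linear with the
  same operator norm, and all other notions below involve only the norm and addition.
\<close>

definition phase_space :: "real \<Rightarrow> (nat \<Rightarrow> 'a::real_normed_vector) set" where
  "phase_space \<gamma> = {\<phi>. bdd_above (range (\<lambda>k. norm (\<phi> k) * exp (\<gamma> * (- real k))))}"

text \<open>Meaningful only on \<open>phase_space \<gamma>\<close>, since the supremum is taken in the reals.\<close>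

definition phase_norm :: "real \<Rightarrow> (nat \<Rightarrow> 'a::real_normed_vector) \<Rightarrow> real" where
  "phase_norm \<gamma> \<phi> = (SUP k. norm (\<phi> k) * exp (\<gamma> * (- real k)))"

text \<open>
  Since \<open>phase_space \<gamma>\<close> is a set and not a type, operators on it are functions on all tuples of
  which only the restriction to \<open>phase_space \<gamma>\<close> is relevant.
\<close>

definition bounded_operators ::
  "real \<Rightarrow> ((nat \<Rightarrow> 'a::real_normed_vector) \<Rightarrow> 'a) set" where
  "bounded_operators \<gamma> = {T.
     (\<forall>\<phi>\<in>phase_space \<gamma>. \<forall>\<psi>\<in>phase_space \<gamma>. T (\<lambda>k. \<phi> k + \<psi> k) = T \<phi> + T \<psi>) \<and>
     (\<forall>c. \<forall>\<phi>\<in>phase_space \<gamma>. T (\<lambda>k. c *\<^sub>R \<phi> k) = c *\<^sub>R T \<phi>) \<and>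
     (\<exists>C. \<forall>\<phi>\<in>phase_space \<gamma>. norm (T \<phi>) \<le> C * phase_norm \<gamma> \<phi>)}"

text \<open>The analogue of \<^const>\<open>onorm\<close>; the zero vector contributes \<open>0 / 0 = 0\<close>.\<close>

definition operator_norm ::
  "real \<Rightarrow> ((nat \<Rightarrow> 'a::real_normed_vector) \<Rightarrow> 'a) \<Rightarrow> real" where
  "operator_norm \<gamma> T = (SUP \<phi>\<in>phase_space \<gamma>. norm (T \<phi>) / phase_norm \<gamma> \<phi>)"

text \<open>The projection onto the coordinates with index at most \<open>m\<close>.\<close>

definition proj_upto :: "int \<Rightarrow> (nat \<Rightarrow> 'a::zero) \<Rightarrow> (nat \<Rightarrow> 'a)" where
  "proj_upto m \<phi> = (\<lambda>k. if - int k \<le> m then \<phi> k else 0)"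

definition prehistory :: "(int \<Rightarrow> 'a) \<Rightarrow> int \<Rightarrow> (nat \<Rightarrow> 'a)" where
  "prehistory x n = (\<lambda>k. x (n - int k))"

definition is_solution ::
  "(nat \<Rightarrow> (nat \<Rightarrow> 'a) \<Rightarrow> 'a) \<Rightarrow> (nat \<Rightarrow> 'a) \<Rightarrow> nat \<Rightarrow> (nat \<Rightarrow> 'a::real_normed_vector)
     \<Rightarrow> (int \<Rightarrow> 'a) \<Rightarrow> bool" where
  "is_solution L f \<tau> \<phi> x \<longleftrightarrow>
     prehistory x (int \<tau>) = \<phi> \<and>
     (\<forall>n\<ge>\<tau>. x (int n + 1) = L n (prehistory x (int n)) + f n)"

definition solution ::
  "(nat \<Rightarrow> (nat \<Rightarrow> 'a) \<Rightarrow> 'a) \<Rightarrow> (nat \<Rightarrow> 'a) \<Rightarrow> nat \<Rightarrow> (nat \<Rightarrow> 'a::real_normed_vector)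
     \<Rightarrow> int \<Rightarrow> 'a" where
  "solution L f \<tau> \<phi> = (THE x. is_solution L f \<tau> \<phi> x)"

lemma ex1_solution: "\<exists>!x. is_solution L f \<tau> \<phi> x"
proof -
  define h where "h = rec_nat \<phi>
    (\<lambda>k \<psi>. case_nat (L (\<tau> + k) \<psi> + f (\<tau> + k)) \<psi>)"
  have h0: "h 0 = \<phi>"
    and hS: "h (Suc k) = case_nat (L (\<tau> + k) (h k) + f (\<tau> + k)) (h k)" for k
    by (simp_all add: h_def)
  define x where
    "x i = (if i \<le> int \<tau> then \<phi> (nat (int \<tau> - i)) else h (nat (i - int \<tau>)) 0)" for i
  have pre: "prehistory x (int (\<tau> + k)) = h k" for k
  proof (induction k)
    case 0
    show ?case by (auto simp: prehistory_def x_def h0)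
  next
    case (Suc k)
    have "prehistory x (int (\<tau> + Suc k)) j = h (Suc k) j" for j
    proof (cases j)
      case 0
      have "nat (int (\<tau> + Suc k) - int \<tau>) = Suc k" by simp
      then show ?thesis using 0 by (simp add: prehistory_def x_def)
    next
      case (Suc i)
      have "prehistory x (int (\<tau> + Suc k)) j = prehistory x (int (\<tau> + k)) i"
        by (simp add: prehistory_def Suc)
      then show ?thesis using Suc.IH by (simp add: hS Suc)
    qed
    then show ?case by blast
  qed
  have "is_solution L f \<tau> \<phi> x"
    unfolding is_solution_def
  proof (intro conjI allI impI)
    show "prehistory x (int \<tau>) = \<phi>" using pre[of 0] by (simp add: h0)
    fix n assume "\<tau> \<le> n"
    then obtain k where n: "n = \<tau> + k" using le_Suc_ex by blast
    have "x (int n + 1) = prehistory x (int (\<tau> + Suc k)) 0"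
      by (simp add: prehistory_def n algebra_simps)
    also have "\<dots> = L n (prehistory x (int n)) + f n"
      by (simp only: pre hS n) simp
    finally show "x (int n + 1) = L n (prehistory x (int n)) + f n" .
  qed
  moreover have "y = z" if y: "is_solution L f \<tau> \<phi> y" and z: "is_solution L f \<tau> \<phi> z" for y z
  proof -
    have eq: "prehistory y (int (\<tau> + k)) = prehistory z (int (\<tau> + k))" for k
    proof (induction k)
      case 0
      show ?case using y z by (simp add: is_solution_def)
    next
      case (Suc k)
      have "y (int (\<tau> + k) + 1) = z (int (\<tau> + k) + 1)"
        using y z Suc.IH unfolding is_solution_def by (metis le_add1)
      moreover have "y (int (\<tau> + k) - int i) = z (int (\<tau> + k) - int i)" for i
        using Suc.IH unfolding prehistory_def by meson
      ultimately have "y (int (\<tau> + Suc k) - int j) = z (int (\<tau> + Suc k) - int j)" for j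
        by (cases j) (simp_all add: algebra_simps)
      then show ?case by (simp add: prehistory_def)
    qed
    show "y = z"
    proof
      fix i
      define k where "k = nat (i - int \<tau>)"
      define j where "j = nat (int (\<tau> + k) - i)"
      have "i = int (\<tau> + k) - int j" by (simp add: k_def j_def)
      then show "y i = z i" using eq[of k] unfolding prehistory_def by metis
    qed
  qed
  ultimately show ?thesis by blast
qed

definition lp_space :: "ennreal \<Rightarrow> (nat \<Rightarrow> 'a::real_normed_vector) set" where
  "lp_space p = {f. if p = \<infinity> then bounded (range f)
                    else summable (\<lambda>n. norm (f n) powr enn2real p)}"

definition lp_lq_stable ::
  "(nat \<Rightarrow> (nat \<Rightarrow> 'a) \<Rightarrow> 'a::real_normed_vector) \<Rightarrow> ennreal \<Rightarrow> ennreal \<Rightarrow> bool" where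
  "lp_lq_stable L p q \<longleftrightarrow>
     (\<forall>f\<in>lp_space p. (\<lambda>n. solution L f 0 (\<lambda>_. 0) (int n)) \<in> lp_space q)"

text \<open>Uniform exponential stability in the state space with respect to \<open>phase_space \<gamma>\<close>.\<close>

definition ues_state ::
  "real \<Rightarrow> (nat \<Rightarrow> (nat \<Rightarrow> 'a) \<Rightarrow> 'a::real_normed_vector) \<Rightarrow> bool" where
  "ues_state \<gamma> L \<longleftrightarrow>
     (\<exists>K\<ge>1. \<exists>\<nu>>0. \<forall>\<tau> n. \<forall>\<phi>\<in>phase_space \<gamma>. \<tau> \<le> n \<longrightarrow>
        norm (solution L (\<lambda>_. 0) \<tau> \<phi> (int n))
          \<le> K * exp (- \<nu> * (real n - real \<tau>)) * phase_norm \<gamma> \<phi>)"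

text \<open>Uniform exponential stability in \<open>phase_space \<gamma>\<close>.\<close>

definition ues_phase ::
  "real \<Rightarrow> (nat \<Rightarrow> (nat \<Rightarrow> 'a) \<Rightarrow> 'a::real_normed_vector) \<Rightarrow> bool" where
  "ues_phase \<gamma> L \<longleftrightarrow>
     (\<exists>K\<ge>1. \<exists>\<nu>>0. \<forall>\<tau> n. \<forall>\<phi>\<in>phase_space \<gamma>. \<tau> \<le> n \<longrightarrow>
        phase_norm \<gamma> (prehistory (solution L (\<lambda>_. 0) \<tau> \<phi>) (int n))
          \<le> K * exp (- \<nu> * (real n - real \<tau>)) * phase_norm \<gamma> \<phi>)"

end

theory Submission
  imports Defs
begin

text \<open>
  Passing from (iii) to (ii), a gliding hump argument on the unit ball of \<open>\<ell>\<^sup>p\<close> turns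
  \<open>(\<ell>\<^sup>p, \<ell>\<^sup>q)\<close>-stability into a uniform bound \<open>C N\<^bsup>1 - 1/q\<^esup>\<close> for the sum of \<open>|x(n)|\<close> over a window of
  length \<open>N\<close>. Every path \<open>w\<close> issuing from zero is the response to the forcing
  \<open>f(n) = w(n + 1) - L(n) w\<^sub>n\<close>, so this bound can be tested on paths of our choice. Short pulses bound
  \<open>L(n)\<close> on each coordinate, and the hypothesis on the projections makes \<open>L(n)\<close> bounded uniformly in \<open>n\<close>.
  A homogeneous solution \<open>y\<close> cut off before \<open>\<tau>\<close> has exponentially small forcing, which gives uniform
  stability. Finally the path \<open>(n - \<tau>) y(n)\<close> has bounded forcing, of \<open>\<ell>\<^sup>p\<close> norm of order \<open>N\<^bsup>1/p\<^esup>\<close> on a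
  window of length \<open>N\<close>; comparing with \<open>N\<^sup>2\<close>, the sum of the weights, the solution decays at least like
  \<open>N\<^bsup>1/p - 1/q - 1\<^esup>\<close>. The exponent is negative exactly because \<open>(p, q) \<noteq> (1, \<infinity>)\<close>, so the solution is halved
  after a fixed time.
\<close>

subsection \<open>The phase space and histories of solutions\<close>

lemma phase_coord_le:
  assumes "\<phi> \<in> phase_space \<gamma>"
  shows "norm (\<phi> k) * exp (- \<gamma> * real k) \<le> phase_norm \<gamma> \<phi>"
  using assms cSUP_upper[of k UNIV "\<lambda>k. norm (\<phi> k) * exp (\<gamma> * (- real k))"]
  by (simp add: phase_space_def phase_norm_def)

lemma phase_norm_ge_head:
  assumes "\<phi> \<in> phase_space \<gamma>"
  shows "norm (\<phi> 0) \<le> phase_norm \<gamma> \<phi>"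
  using phase_coord_le[OF assms, of 0] by simp

lemma phase_norm_nonneg:
  assumes "\<phi> \<in> phase_space \<gamma>"
  shows "0 \<le> phase_norm \<gamma> \<phi>"
  using phase_norm_ge_head[OF assms] norm_ge_zero order_trans by blast

lemma phase_spaceI:
  assumes "\<And>k. norm (\<phi> k) * exp (- \<gamma> * real k) \<le> c"
  shows "\<phi> \<in> phase_space \<gamma>"
  using assms by (auto simp: phase_space_def intro!: bdd_aboveI[of _ c])

lemma phase_norm_le:
  assumes "\<And>k. norm (\<phi> k) * exp (- \<gamma> * real k) \<le> c"
  shows "phase_norm \<gamma> \<phi> \<le> c"
  unfolding phase_norm_def by (rule cSUP_least) (use assms in auto)

lemma phase_norm_zero [simp]: "phase_norm \<gamma> (\<lambda>_. 0) = 0"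
  by (simp add: phase_norm_def)

lemma phase_space_zero [simp]: "(\<lambda>_. 0) \<in> phase_space \<gamma>"
  by (rule phase_spaceI[of _ _ 0]) simp

lemma phase_space_scale:
  assumes "\<phi> \<in> phase_space \<gamma>"
  shows "(\<lambda>k. c *\<^sub>R \<phi> k) \<in> phase_space \<gamma>"
  by (rule phase_spaceI[of _ _ "\<bar>c\<bar> * phase_norm \<gamma> \<phi>"])
    (use phase_coord_le[OF assms] in \<open>simp add: mult_left_mono mult.assoc\<close>)

lemma phase_space_finite_support:
  assumes "\<And>k. k > n \<Longrightarrow> \<phi> k = 0"
  shows "\<phi> \<in> phase_space \<gamma>"
proof (rule phase_spaceI)
  fix k
  show "norm (\<phi> k) * exp (- \<gamma> * real k) \<le> (\<Sum>i\<le>n. norm (\<phi> i) * exp (- \<gamma> * real i))"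
  proof (cases "k \<le> n")
    case True
    then show ?thesis
      by (intro member_le_sum) auto
  qed (auto simp: assms intro!: sum_nonneg)
qed

lemma phase_space_single: "(\<lambda>i. if i = k then v else 0) \<in> phase_space \<gamma>"
  by (rule phase_space_finite_support[of k]) auto

text \<open>The new value gets weight 1, and every old coordinate moves back one place, which
  multiplies its weight by \<open>exp (- \<gamma>)\<close>. This fading memory turns bounds on
  solutions into bounds on histories.\<close>

lemma
  assumes "\<psi> \<in> phase_space \<gamma>"
  shows phase_space_case_nat: "case_nat v \<psi> \<in> phase_space \<gamma>"
    and phase_norm_case_nat:
      "phase_norm \<gamma> (case_nat v \<psi>) \<le> max (norm v) (exp (- \<gamma>) * phase_norm \<gamma> \<psi>)"
proof -
  have "norm (case_nat v \<psi> k) * exp (- \<gamma> * real k) \<le> max (norm v) (exp (- \<gamma>) * phase_norm \<gamma> \<psi>)" for k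
  proof (cases k)
    case (Suc i)
    have "norm (\<psi> i) * exp (- \<gamma> * real k) = exp (- \<gamma>) * (norm (\<psi> i) * exp (- \<gamma> * real i))"
      by (simp add: Suc algebra_simps flip: exp_add)
    also have "\<dots> \<le> exp (- \<gamma>) * phase_norm \<gamma> \<psi>"
      using phase_coord_le[OF assms] by (intro mult_left_mono) auto
    finally show ?thesis by (simp add: Suc)
  qed simp
  then show "case_nat v \<psi> \<in> phase_space \<gamma>"
    and "phase_norm \<gamma> (case_nat v \<psi>) \<le> max (norm v) (exp (- \<gamma>) * phase_norm \<gamma> \<psi>)"
    by (rule phase_spaceI, rule phase_norm_le)
qed

section \<open>Histories as iterates of the one-step map\<close>

text \<open>The history \<open>k\<close> steps after the starting time \<tau>. Iterating whole
  tuples keeps time in the natural numbers and allows induction on \<open>k\<close>.\<close>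

primrec hist ::
  "(nat \<Rightarrow> (nat \<Rightarrow> 'a) \<Rightarrow> 'a) \<Rightarrow> (nat \<Rightarrow> 'a) \<Rightarrow> nat \<Rightarrow> (nat \<Rightarrow> 'a::real_normed_vector)
     \<Rightarrow> nat \<Rightarrow> nat \<Rightarrow> 'a" where
  "hist L f \<tau> \<phi> 0 = \<phi>"
| "hist L f \<tau> \<phi> (Suc k) = case_nat (L (\<tau> + k) (hist L f \<tau> \<phi> k) + f (\<tau> + k)) (hist L f \<tau> \<phi> k)"

lemma prehistory_solution: "prehistory (solution L f \<tau> \<phi>) (int (\<tau> + k)) = hist L f \<tau> \<phi> k"
proof (induction k)
  case 0
  have "is_solution L f \<tau> \<phi> (solution L f \<tau> \<phi>)"
    unfolding solution_def by (rule theI'[OF ex1_solution])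
  then show ?case by (simp add: is_solution_def)
next
  case (Suc k)
  let ?x = "solution L f \<tau> \<phi>"
  have "is_solution L f \<tau> \<phi> ?x"
    unfolding solution_def by (rule theI'[OF ex1_solution])
  then have "?x (int (\<tau> + k) + 1) = L (\<tau> + k) (hist L f \<tau> \<phi> k) + f (\<tau> + k)"
    unfolding is_solution_def by (metis Suc le_add1)
  moreover have "?x (int (\<tau> + k) - int i) = hist L f \<tau> \<phi> k i" for i
    using fun_cong[OF Suc, of i] by (simp add: prehistory_def)
  ultimately have "prehistory ?x (int (\<tau> + Suc k)) j = hist L f \<tau> \<phi> (Suc k) j" for j
    by (cases j) (simp_all add: prehistory_def algebra_simps)
  then show ?case by blast
qed

lemma solution_eq_hist: "solution L f \<tau> \<phi> (int (\<tau> + k)) = hist L f \<tau> \<phi> k 0"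
  using fun_cong[OF prehistory_solution, of L f \<tau> \<phi> k 0] by (simp add: prehistory_def)

lemma solution_zero_eq_hist: "solution L f 0 \<phi> (int k) = hist L f 0 \<phi> k 0"
  using solution_eq_hist[of L f 0 \<phi> k] by simp

text \<open>Passing to the elapsed time \<open>k = n - \<tau>\<close> leaves estimates on
  \<open>hist\<close> alone, without differences of times.\<close>

lemma ues_state_hist:
  "ues_state \<gamma> L \<longleftrightarrow> (\<exists>K\<ge>1. \<exists>\<nu>>0. \<forall>\<tau> k. \<forall>\<phi>\<in>phase_space \<gamma>.
     norm (hist L (\<lambda>_. 0) \<tau> \<phi> k 0) \<le> K * exp (- \<nu> * real k) * phase_norm \<gamma> \<phi>)"
proof -
  have "(\<forall>\<tau> n. \<forall>\<phi>\<in>phase_space \<gamma>. \<tau> \<le> n \<longrightarrow>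
          norm (solution L (\<lambda>_. 0) \<tau> \<phi> (int n))
          \<le> K * exp (- \<nu> * (real n - real \<tau>)) * phase_norm \<gamma> \<phi>) \<longleftrightarrow>
        (\<forall>\<tau> k. \<forall>\<phi>\<in>phase_space \<gamma>.
          norm (hist L (\<lambda>_. 0) \<tau> \<phi> k 0) \<le> K * exp (- \<nu> * real k) * phase_norm \<gamma> \<phi>)"
    (is "?A \<longleftrightarrow> ?B") for K \<nu>
  proof
    assume A: ?A
    show ?B
    proof (intro allI ballI)
      fix \<tau> k and \<phi> :: "nat \<Rightarrow> 'a" assume "\<phi> \<in> phase_space \<gamma>"
      then show "norm (hist L (\<lambda>_. 0) \<tau> \<phi> k 0) \<le> K * exp (- \<nu> * real k) * phase_norm \<gamma> \<phi>"
        using A[rule_format, of \<phi> \<tau> "\<tau> + k"] by (simp only: solution_eq_hist) simp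
    qed
  next
    assume B: ?B
    show ?A
    proof (intro allI ballI impI)
      fix \<tau> n :: nat and \<phi> :: "nat \<Rightarrow> 'a" assume "\<phi> \<in> phase_space \<gamma>" "\<tau> \<le> n"
      moreover obtain k where "n = \<tau> + k" using \<open>\<tau> \<le> n\<close> le_Suc_ex by blast
      ultimately show "norm (solution L (\<lambda>_. 0) \<tau> \<phi> (int n))
          \<le> K * exp (- \<nu> * (real n - real \<tau>)) * phase_norm \<gamma> \<phi>"
        using B[rule_format, of \<phi> \<tau> k] by (simp only: solution_eq_hist) simp
    qed
  qed
  then show ?thesis unfolding ues_state_def by presburger
qed

lemma ues_phase_hist:
  "ues_phase \<gamma> L \<longleftrightarrow> (\<exists>K\<ge>1. \<exists>\<nu>>0. \<forall>\<tau> k. \<forall>\<phi>\<in>phase_space \<gamma>.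
     phase_norm \<gamma> (hist L (\<lambda>_. 0) \<tau> \<phi> k) \<le> K * exp (- \<nu> * real k) * phase_norm \<gamma> \<phi>)"
proof -
  have "(\<forall>\<tau> n. \<forall>\<phi>\<in>phase_space \<gamma>. \<tau> \<le> n \<longrightarrow>
          phase_norm \<gamma> (prehistory (solution L (\<lambda>_. 0) \<tau> \<phi>) (int n))
          \<le> K * exp (- \<nu> * (real n - real \<tau>)) * phase_norm \<gamma> \<phi>) \<longleftrightarrow>
        (\<forall>\<tau> k. \<forall>\<phi>\<in>phase_space \<gamma>.
          phase_norm \<gamma> (hist L (\<lambda>_. 0) \<tau> \<phi> k) \<le> K * exp (- \<nu> * real k) * phase_norm \<gamma> \<phi>)"
    (is "?A \<longleftrightarrow> ?B") for K \<nu>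
  proof
    assume A: ?A
    show ?B
    proof (intro allI ballI)
      fix \<tau> k and \<phi> :: "nat \<Rightarrow> 'a" assume "\<phi> \<in> phase_space \<gamma>"
      then show "phase_norm \<gamma> (hist L (\<lambda>_. 0) \<tau> \<phi> k) \<le> K * exp (- \<nu> * real k) * phase_norm \<gamma> \<phi>"
        using A[rule_format, of \<phi> \<tau> "\<tau> + k"] by (simp only: prehistory_solution) simp
    qed
  next
    assume B: ?B
    show ?A
    proof (intro allI ballI impI)
      fix \<tau> n :: nat and \<phi> :: "nat \<Rightarrow> 'a" assume "\<phi> \<in> phase_space \<gamma>" "\<tau> \<le> n"
      moreover obtain k where "n = \<tau> + k" using \<open>\<tau> \<le> n\<close> le_Suc_ex by blast
      ultimately show "phase_norm \<gamma> (prehistory (solution L (\<lambda>_. 0) \<tau> \<phi>) (int n))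
          \<le> K * exp (- \<nu> * (real n - real \<tau>)) * phase_norm \<gamma> \<phi>"
        using B[rule_format, of \<phi> \<tau> k] by (simp only: prehistory_solution) simp
    qed
  qed
  then show ?thesis unfolding ues_phase_def by presburger
qed

text \<open>Causality: a forcing can be cut off after a given time without changing the path up to
  that time.\<close>

lemma hist_cong:
  assumes "\<And>j. j < k \<Longrightarrow> f (\<tau> + j) = g (\<tau> + j)"
  shows "hist L f \<tau> \<phi> k = hist L g \<tau> \<phi> k"
  using assms by (induction k) auto

text \<open>The evolution property: a solution may be restarted from any history it has
  reached.\<close>

lemma hist_add: "hist L f \<tau> \<phi> (j + k) = hist L f (\<tau> + j) (hist L f \<tau> \<phi> j) k"
  by (induction k) (simp_all add: add.assoc)

lemma hist_coord:
  "hist L f \<tau> \<phi> k l = (if l \<le> k then hist L f \<tau> \<phi> (k - l) 0 else \<phi> (l - k))"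
proof (induction k arbitrary: l)
  case (Suc k)
  show ?case
    by (cases l) (auto simp: Suc[of "l - 1"] simp del: hist.simps(2), simp_all add: Suc)
qed auto

text \<open>The history at time \<open>n\<close> of the path \<open>w\<close> continued by zero to
  negative times.\<close>

definition padded :: "(nat \<Rightarrow> 'a::zero) \<Rightarrow> nat \<Rightarrow> nat \<Rightarrow> 'a" where
  "padded w n = (\<lambda>l. if l \<le> n then w (n - l) else 0)"

lemma padded_Suc: "padded w (Suc n) = case_nat (w (Suc n)) (padded w n)"
  by (auto simp: padded_def split: nat.splits)

text \<open>The forcing is read off from the equation, so that paths, rather than forcings, can be
  prescribed.\<close>

lemma hist_padded:
  assumes "w 0 = 0"
  shows "hist L (\<lambda>j. w (Suc j) - L j (padded w j)) 0 (\<lambda>_. 0) n = padded w n"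
proof (induction n)
  case (Suc n)
  then show ?case by (simp add: padded_Suc)
qed (use assms in \<open>auto simp: padded_def\<close>)

section \<open>Operator norms on the phase space\<close>

lemma phase_norm_add:
  assumes "\<phi> \<in> phase_space \<gamma>" "\<psi> \<in> phase_space \<gamma>"
  shows "phase_norm \<gamma> (\<lambda>k. \<phi> k + \<psi> k) \<le> phase_norm \<gamma> \<phi> + phase_norm \<gamma> \<psi>"
proof (rule phase_norm_le)
  fix k
  have "norm (\<phi> k + \<psi> k) * exp (- \<gamma> * real k)
      \<le> norm (\<phi> k) * exp (- \<gamma> * real k) + norm (\<psi> k) * exp (- \<gamma> * real k)"
    by (simp add: norm_triangle_ineq flip: distrib_right)
  also have "\<dots> \<le> phase_norm \<gamma> \<phi> + phase_norm \<gamma> \<psi>"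
    by (intro add_mono phase_coord_le assms)
  finally show "norm (\<phi> k + \<psi> k) * exp (- \<gamma> * real k) \<le> phase_norm \<gamma> \<phi> + phase_norm \<gamma> \<psi>" .
qed

text \<open>The constant \<open>C\<close> bounds the set of quotients, so that their real supremum
  is an upper bound; it also forces \<open>T \<phi> = 0\<close> when the phase norm of \<phi>
  vanishes.\<close>

lemma bounded_operator_le_operator_norm:
  assumes T: "\<And>\<phi>. \<phi> \<in> phase_space \<gamma> \<Longrightarrow> norm (T \<phi>) \<le> C * phase_norm \<gamma> \<phi>"
    and \<phi>: "\<phi> \<in> phase_space \<gamma>"
  shows "norm (T \<phi>) \<le> operator_norm \<gamma> T * phase_norm \<gamma> \<phi>"
proof (cases "phase_norm \<gamma> \<phi> = 0")
  case True
  then show ?thesis using T[OF \<phi>] by simp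
next
  case False
  then have pos: "0 < phase_norm \<gamma> \<phi>" using phase_norm_nonneg[OF \<phi>] by simp
  \<comment> \<open>The constant \<open>C\<close> may be negative, whereas a vanishing denominator
    gives the quotient 0.\<close>
  have "norm (T \<psi>) / phase_norm \<gamma> \<psi> \<le> max C 0" if "\<psi> \<in> phase_space \<gamma>" for \<psi>
  proof (cases "phase_norm \<gamma> \<psi> = 0")
    case False
    then have "0 < phase_norm \<gamma> \<psi>" using phase_norm_nonneg[OF that] by simp
    then have "norm (T \<psi>) / phase_norm \<gamma> \<psi> \<le> C" using T[OF that] by (simp add: divide_le_eq)
    then show ?thesis by simp
  qed simp
  then have "bdd_above ((\<lambda>\<psi>. norm (T \<psi>) / phase_norm \<gamma> \<psi>) ` phase_space \<gamma>)"
    by (rule bdd_aboveI2)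
  then have "norm (T \<phi>) / phase_norm \<gamma> \<phi> \<le> operator_norm \<gamma> T"
    unfolding operator_norm_def by (rule cSUP_upper[OF \<phi>])
  then show ?thesis using pos by (simp add: divide_le_eq)
qed

lemma operator_norm_le:
  assumes "\<And>\<phi>. \<phi> \<in> phase_space \<gamma> \<Longrightarrow> norm (T \<phi>) \<le> C * phase_norm \<gamma> \<phi>" "0 \<le> C"
  shows "operator_norm \<gamma> T \<le> C"
  unfolding operator_norm_def
proof (rule cSUP_least)
  show "phase_space \<gamma> \<noteq> ({} :: (nat \<Rightarrow> 'a) set)" using phase_space_zero by blast
  fix \<phi> :: "nat \<Rightarrow> 'a" assume \<phi>: "\<phi> \<in> phase_space \<gamma>"
  show "norm (T \<phi>) / phase_norm \<gamma> \<phi> \<le> C"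
    using assms(1)[OF \<phi>] assms(2) phase_norm_nonneg[OF \<phi>]
    by (cases "phase_norm \<gamma> \<phi> = 0") (auto simp: divide_le_eq)
qed

subsection \<open>Uniform boundedness\<close>

text \<open>
  A gliding hump. The signs in front of the humps are chosen so that no hump is cancelled by its
  predecessors, which avoids any estimate of the partial sums.
\<close>

lemma uniform_boundedness_sequence_ball:
  fixes B :: "(nat \<Rightarrow> 'a::banach) set" and T :: "'i \<Rightarrow> (nat \<Rightarrow> 'a) \<Rightarrow> real"
  assumes ne: "B \<noteq> {}"
    and bnd: "\<And>f n. f \<in> B \<Longrightarrow> norm (f n) \<le> 1"
    and neg: "\<And>f. f \<in> B \<Longrightarrow> (\<lambda>n. - f n) \<in> B"
    and conv: "\<And>f g u v. f \<in> B \<Longrightarrow> g \<in> B \<Longrightarrow> 0 \<le> u \<Longrightarrow> 0 \<le> v \<Longrightarrow> u + v = 1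
      \<Longrightarrow> (\<lambda>n. u *\<^sub>R f n + v *\<^sub>R g n) \<in> B"
    and clos: "\<And>F f. (\<And>k. F k \<in> B) \<Longrightarrow> (\<And>n. (\<lambda>k. F k n) \<longlonglongrightarrow> f n) \<Longrightarrow> f \<in> B"
    and T_add: "\<And>i f g. T i (\<lambda>n. f n + g n) \<le> T i f + T i g"
    and T_scale: "\<And>i c f. T i (\<lambda>n. c *\<^sub>R f n) = \<bar>c\<bar> * T i f"
    and T_bdd: "\<And>i. \<exists>c. \<forall>f\<in>B. T i f \<le> c"
    and T_pointwise: "\<And>f. f \<in> B \<Longrightarrow> \<exists>C. \<forall>i. T i f \<le> C"
  shows "\<exists>C. \<forall>i. \<forall>f\<in>B. T i f \<le> C"
proof (rule ccontr)
  assume contra: "\<nexists>C. \<forall>i. \<forall>f\<in>B. T i f \<le> C"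
  define N where "N i = Sup (T i ` B)" for i
  have bdd: "bdd_above (T i ` B)" for i
    using T_bdd[of i] by (auto intro: bdd_aboveI)
  have T_le: "T i f \<le> N i" if "f \<in> B" for i f
    unfolding N_def by (rule cSUP_upper[OF that bdd])
  have T_neg: "T i (\<lambda>n. - f n) = T i f" for i f
    using T_scale[of i "-1" f] by simp
  \<comment> \<open>If the bound fails, there are indices whose supremum over the ball is at least
    \<open>4 ^ j\<close>; the hump \<open>g\<close> nearly attains it. The growth 4 is to beat the
    scaling \<open>(1/3) ^ j\<close> of the humps.\<close>
  have "\<exists>i g. g \<in> B \<and> 3/4 * N i \<le> T i g \<and> 4 ^ j \<le> N i" for j :: nat
  proof -
    obtain i f where f: "f \<in> B" "4 ^ j < T i f"
      using contra by (meson not_le)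
    have N: "4 ^ j < N i" using f T_le[of f i] by linarith
    then have "0 < N i" by (meson less_trans zero_less_numeral zero_less_power)
    then have "3/4 * N i < N i" by simp
    then obtain g where "g \<in> B" "3/4 * N i < T i g"
      unfolding N_def using less_cSUP_iff[OF ne bdd] by blast
    with N show ?thesis by (meson less_imp_le)
  qed
  then obtain \<iota> g where gB: "g j \<in> B" and Tg: "3/4 * N (\<iota> j) \<le> T (\<iota> j) (g j)"
    and N4: "4 ^ j \<le> N (\<iota> j)" for j
    by metis
  \<comment> \<open>The partial sums of the signed humps; each sign depends on the sum of the
    preceding ones.\<close>
  define x where "x = rec_nat (\<lambda>_. 0)
    (\<lambda>j y. if (1/3) ^ j * T (\<iota> j) (g j) \<le> T (\<iota> j) (\<lambda>n. y n + (1/3) ^ j *\<^sub>R g j n)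
           then (\<lambda>n. y n + (1/3) ^ j *\<^sub>R g j n) else (\<lambda>n. y n - (1/3) ^ j *\<^sub>R g j n))"
  have x0: "x 0 = (\<lambda>_. 0)" by (simp add: x_def)
  have xS: "x (Suc j) =
      (if (1/3) ^ j * T (\<iota> j) (g j) \<le> T (\<iota> j) (\<lambda>n. x j n + (1/3) ^ j *\<^sub>R g j n)
       then (\<lambda>n. x j n + (1/3) ^ j *\<^sub>R g j n) else (\<lambda>n. x j n - (1/3) ^ j *\<^sub>R g j n))" for j
    by (simp add: x_def)
  \<comment> \<open>The two candidates differ by twice the scaled hump, so by the triangle
    inequality one of them has at least the seminorm of that hump.\<close>
  have hump: "(1/3) ^ j * T (\<iota> j) (g j) \<le> T (\<iota> j) (x (Suc j))" for j
  proof -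
    let ?e = "(1/3::real) ^ j"
    have "2 * (?e * T (\<iota> j) (g j)) = T (\<iota> j) (\<lambda>n. (2 * ?e) *\<^sub>R g j n)"
      by (simp add: T_scale)
    also have "(\<lambda>n. (2 * ?e) *\<^sub>R g j n)
        = (\<lambda>n. (x j n + ?e *\<^sub>R g j n) + - (x j n - ?e *\<^sub>R g j n))"
      by (simp add: algebra_simps flip: scaleR_left_distrib)
    also have "T (\<iota> j) \<dots> \<le> T (\<iota> j) (\<lambda>n. x j n + ?e *\<^sub>R g j n)
        + T (\<iota> j) (\<lambda>n. - (x j n - ?e *\<^sub>R g j n))"
      by (rule T_add)
    also have "T (\<iota> j) (\<lambda>n. - (x j n - ?e *\<^sub>R g j n)) = T (\<iota> j) (\<lambda>n. x j n - ?e *\<^sub>R g j n)"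
      by (rule T_neg)
    finally show ?thesis unfolding xS by auto
  qed
  have "\<exists>h\<in>B. \<forall>n. x (Suc j) n = x j n + (1/3) ^ j *\<^sub>R h n" for j
  proof (cases "x (Suc j) = (\<lambda>n. x j n + (1/3) ^ j *\<^sub>R g j n)")
    case False
    then have "x (Suc j) = (\<lambda>n. x j n - (1/3) ^ j *\<^sub>R g j n)"
      unfolding xS by argo
    then show ?thesis using neg[OF gB[of j]] by (intro bexI[of _ "\<lambda>n. - g j n"]) auto
  qed (use gB in auto)
  then obtain h where hB: "h j \<in> B" and xh: "x (Suc j) n = x j n + (1/3) ^ j *\<^sub>R h j n" for j n
    by metis
  \<comment> \<open>The factor \<open>2/3 * 3 ^ k\<close> is the reciprocal of the sum of
    \<open>(1/3) ^ j\<close> over \<open>j \<ge> k\<close>. Splitting off the first hump gives a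
    convex combination with weights 2/3 and 1/3; for \<open>d = 0\<close>, zero is the midpoint of
    \<open>h 0\<close> and its negative.\<close>
  have tail: "(\<lambda>n. (2/3 * 3 ^ k) *\<^sub>R (x (k + d) n - x k n)) \<in> B" for k d
  proof (induction d arbitrary: k)
    case 0
    have "(\<lambda>n. (1/2) *\<^sub>R h 0 n + (1/2) *\<^sub>R (- h 0 n)) \<in> B"
      by (rule conv) (use hB neg in auto)
    then show ?case by simp
  next
    case (Suc d)
    have "(\<lambda>n. (2/3) *\<^sub>R h k n + (1/3) *\<^sub>R ((2/3 * 3 ^ Suc k) *\<^sub>R (x (Suc k + d) n - x (Suc k) n))) \<in> B"
      by (rule conv) (use hB Suc.IH[of "Suc k"] in auto)
    also have "(\<lambda>n. (2/3) *\<^sub>R h k n + (1/3) *\<^sub>R ((2/3 * 3 ^ Suc k) *\<^sub>R (x (Suc k + d) n - x (Suc k) n)))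
        = (\<lambda>n. (2/3 * 3 ^ k) *\<^sub>R (x (k + Suc d) n - x k n))"
      by (simp add: xh algebra_simps power_one_over)
    finally show ?case .
  qed
  have Cau: "Cauchy (\<lambda>k. x k n)" for n
  proof (rule CauchyI)
    fix e :: real assume "0 < e"
    then obtain K where K: "(1/3::real) ^ K < e / 3"
      using real_arch_pow_inv[of "e/3" "1/3"] by auto
    have close: "norm (x (K + d) n - x K n) < e / 2" for d
    proof -
      have "2/3 * 3 ^ K * norm (x (K + d) n - x K n) \<le> 1"
        using bnd[OF tail[of K d], of n] by simp
      then have "norm (x (K + d) n - x K n) \<le> 3/2 * (1/3) ^ K"
        by (simp add: field_simps power_one_over)
      then show ?thesis using K by simp
    qed
    have "norm (x m n - x l n) < e" if "K \<le> m" "K \<le> l" for m l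
    proof -
      have "norm (x m n - x K n) < e / 2" "norm (x l n - x K n) < e / 2"
        using close[of "m - K"] close[of "l - K"] that by auto
      then have "norm ((x m n - x K n) - (x l n - x K n)) < e"
        using norm_triangle_ineq4[of "x m n - x K n" "x l n - x K n"] by linarith
      then show ?thesis by simp
    qed
    then show "\<exists>M. \<forall>m\<ge>M. \<forall>l\<ge>M. norm (x m n - x l n) < e" by blast
  qed
  define X where "X n = lim (\<lambda>k. x k n)" for n
  have lim: "(\<lambda>k. x k n) \<longlonglongrightarrow> X n" for n
    using Cau Cauchy_convergent convergent_LIMSEQ_iff unfolding X_def by blast
  \<comment> \<open>Closedness of the ball under pointwise limits carries the tails over to the
    limit; \<open>k = 0\<close> puts \<open>2/3\<close> times \<open>X\<close> into the
    ball.\<close>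
  have tailX: "(\<lambda>n. (2/3 * 3 ^ k) *\<^sub>R (X n - x k n)) \<in> B" for k
  proof (rule clos[OF tail])
    fix n
    have "(\<lambda>d. x (d + k) n) \<longlonglongrightarrow> X n"
      by (rule LIMSEQ_ignore_initial_segment[OF lim])
    then show "(\<lambda>d. (2/3 * 3 ^ k) *\<^sub>R (x (k + d) n - x k n)) \<longlonglongrightarrow> (2/3 * 3 ^ k) *\<^sub>R (X n - x k n)"
      by (intro tendsto_intros) (simp add: add.commute)
  qed
  obtain C where C: "T i (\<lambda>n. (2/3) *\<^sub>R X n) \<le> C" for i
    using T_pointwise[OF tailX[of 0]] by (auto simp: x0)
  \<comment> \<open>In units of \<open>(1/3) ^ j * N (\<iota> j)\<close>, the hump contributes at
    least 3/4 and the later ones remove at most 1/2. The remaining 1/4 is at most the seminorm of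
    \<open>X\<close>, hence at most \<open>3/2 * C\<close>.\<close>
  have "(4/3) ^ j \<le> 6 * C" for j
  proof -
    let ?T = "T (\<iota> j)" and ?N = "N (\<iota> j)"
    have *: "3/4 * ((1/3) ^ j * ?N) \<le> (1/3) ^ j * ?T (g j)"
      using mult_left_mono[OF Tg[of j], of "(1/3) ^ j"] by (simp add: algebra_simps)
    have "?T (x (Suc j)) = ?T (\<lambda>n. X n + - (X n - x (Suc j) n))" by simp
    also have "\<dots> \<le> ?T X + ?T (\<lambda>n. - (X n - x (Suc j) n))"
      by (rule T_add)
    also have "?T (\<lambda>n. - (X n - x (Suc j) n)) = ?T (\<lambda>n. X n - x (Suc j) n)"
      by (rule T_neg)
    also have "\<dots> \<le> 1/2 * ((1/3) ^ j * ?N)"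
      using T_le[OF tailX[of "Suc j"], of "\<iota> j"] unfolding T_scale
      by (simp add: field_simps power_one_over)
    finally have "?T (x (Suc j)) \<le> ?T X + 1/2 * ((1/3) ^ j * ?N)" by simp
    moreover have "?T X \<le> 3/2 * C"
      using C[of "\<iota> j"] unfolding T_scale by simp
    ultimately have "(1/3) ^ j * ?N \<le> 6 * C" using hump[of j] * by linarith
    moreover have "(1/3) ^ j * 4 ^ j \<le> (1/3) ^ j * ?N"
      by (intro mult_left_mono N4) simp
    moreover have "(1/3::real) ^ j * 4 ^ j = (4/3) ^ j"
      by (simp flip: power_mult_distrib)
    ultimately show ?thesis by linarith
  qed
  moreover obtain j where "6 * C < (4/3) ^ j"
    using real_arch_pow[of "4/3" "6 * C"] by auto
  ultimately show False by (meson not_le)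
qed

subsection \<open>Sequence spaces\<close>

text \<open>Inside the open half line this is \<open>powr_convex\<close>; if an endpoint is 0, it
  reduces to \<open>u powr r \<le> u\<close> for \<open>0 < u < 1\<close>.\<close>

lemma convex_on_powr_nonneg:
  fixes r :: real
  assumes "1 \<le> r"
  shows "convex_on {0..} (\<lambda>x. x powr r)"
proof (rule convex_onI)
  have *: "(u * z) powr r \<le> u * z powr r" if "0 < u" "u < 1" "0 \<le> z" for u z :: real
  proof -
    have "u powr r \<le> u" using powr_mono'[of 1 r u] that assms by simp
    then show ?thesis using that by (simp add: powr_mult mult_right_mono)
  qed
  fix t x y :: real
  assume t: "0 < t" "t < 1" and xy: "x \<in> {0..}" "y \<in> {0..}"
  show "((1 - t) *\<^sub>R x + t *\<^sub>R y) powr r \<le> (1 - t) * x powr r + t * y powr r"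
  proof (cases "x = 0 \<or> y = 0")
    case True
    then show ?thesis using *[of t y] *[of "1 - t" x] t xy by auto
  next
    case False
    then show ?thesis
      using convex_onD[OF powr_convex[OF assms], of t x y] t xy by auto
  qed
qed simp

text \<open>Jensen's inequality for the power \<open>r\<close>, which amounts to the Hoelder
  comparison of the 1-norm and the r-norm on a finite set.\<close>

lemma sum_le_powr_mean:
  fixes v :: "nat \<Rightarrow> real"
  assumes r: "1 \<le> r" and W: "finite W" "W \<noteq> {}" and v: "\<And>n. n \<in> W \<Longrightarrow> 0 \<le> v n"
    and S: "(\<Sum>n\<in>W. v n powr r) \<le> S"
  shows "(\<Sum>n\<in>W. v n) \<le> S powr (1 / r) * real (card W) powr (1 - 1 / r)"
proof -
  let ?N = "real (card W)"
  have N: "?N > 0" using W by (simp add: card_gt_0_iff)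
  have S0: "0 \<le> S" using order_trans[OF sum_nonneg S] by simp
  have "(\<Sum>n\<in>W. (1 / ?N) *\<^sub>R v n) powr r \<le> (\<Sum>n\<in>W. 1 / ?N * v n powr r)"
    by (rule convex_on_sum[OF W convex_on_powr_nonneg[OF r]]) (use v N in auto)
  also have "\<dots> \<le> S / ?N"
    using S N by (simp add: divide_right_mono flip: sum_divide_distrib)
  finally have "((\<Sum>n\<in>W. v n) / ?N) powr r \<le> S / ?N"
    by (simp flip: sum_divide_distrib)
  then have "(((\<Sum>n\<in>W. v n) / ?N) powr r) powr (1 / r) \<le> (S / ?N) powr (1 / r)"
    using r by (intro powr_mono2) auto
  moreover have "0 \<le> (\<Sum>n\<in>W. v n)" using v by (rule sum_nonneg)
  ultimately have "(\<Sum>n\<in>W. v n) / ?N \<le> (S / ?N) powr (1 / r)"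
    using r by (simp add: powr_powr)
  then have "(\<Sum>n\<in>W. v n) \<le> (S / ?N) powr (1 / r) * ?N"
    using N by (simp add: field_simps)
  also have "\<dots> = S powr (1 / r) * ?N powr (1 - 1 / r)"
    using N S0 by (simp add: powr_divide powr_diff)
  finally show ?thesis .
qed

lemma ennreal_ge_1_cases:
  assumes "1 \<le> (p::ennreal)"
  obtains "p = \<infinity>" | r where "p = ennreal r" "1 \<le> r"
proof (cases p)
  case (real r)
  then show ?thesis using assms that(2)[of r] by (simp add: ennreal_1[symmetric] del: ennreal_1)
qed (use that(1) in simp)

lemma enn2real_inverse_ennreal: "1 \<le> r \<Longrightarrow> enn2real (inverse (ennreal r)) = 1 / r"
  by (simp add: inverse_ennreal inverse_eq_divide)

text \<open>By Hoelder, window sums grow at most like \<open>N powr (1 - 1/q)\<close>. Normalised in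
  this way they form one family of seminorms for finite and infinite \<open>q\<close>, the inverse
  of \<infinity> being 0.\<close>

lemma lp_space_window_sum:
  assumes "1 \<le> q" "v \<in> lp_space q"
  shows "\<exists>C. \<forall>\<tau> N. real N powr (enn2real (inverse q) - 1) * (\<Sum>n\<in>{\<tau><..\<tau>+N}. norm (v n)) \<le> C"
  using assms(1)
proof (cases rule: ennreal_ge_1_cases)
  case 1
  then obtain b where b: "norm (v n) \<le> b" for n
    using assms(2) by (auto simp: lp_space_def bounded_iff)
  have "real N powr (- 1) * (\<Sum>n\<in>{\<tau><..\<tau>+N}. norm (v n)) \<le> b" for \<tau> N
  proof (cases "N = 0")
    case True
    then show ?thesis using order_trans[OF norm_ge_zero b] by simp
  next
    case False
    have "(\<Sum>n\<in>{\<tau><..\<tau>+N}. norm (v n)) \<le> real N * b"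
      using sum_bounded_above[of "{\<tau><..\<tau>+N}" "\<lambda>n. norm (v n)" b] b by simp
    then show ?thesis using False by (simp add: powr_minus field_simps)
  qed
  with 1 show ?thesis by auto
next
  case (2 r)
  then have sm: "summable (\<lambda>n. norm (v n) powr r)"
    using assms(2) by (simp add: lp_space_def)
  define S where "S = (\<Sum>n. norm (v n) powr r)"
  have "real N powr (1 / r - 1) * (\<Sum>n\<in>{\<tau><..\<tau>+N}. norm (v n)) \<le> S powr (1 / r)" for \<tau> N
  proof (cases "N = 0")
    case False
    have "(\<Sum>n\<in>{\<tau><..\<tau>+N}. norm (v n)) \<le> S powr (1 / r) * real (card {\<tau><..\<tau>+N}) powr (1 - 1 / r)"
      unfolding S_def
      by (rule sum_le_powr_mean) (use 2 False in \<open>auto intro!: sum_le_suminf sm\<close>)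
    then have "real N powr (1 / r - 1) * (\<Sum>n\<in>{\<tau><..\<tau>+N}. norm (v n))
        \<le> real N powr (1 / r - 1) * (S powr (1 / r) * real N powr (1 - 1 / r))"
      by (intro mult_left_mono) auto
    also have "\<dots> = S powr (1 / r)"
      using False by (simp add: mult.left_commute flip: powr_add)
    finally show ?thesis .
  qed simp
  with 2 show ?thesis by (auto simp: enn2real_inverse_ennreal)
qed

section \<open>Unit balls of the sequence spaces\<close>

text \<open>Bounding all partial sums avoids infinite sums and roots, and is a condition that
  survives pointwise limits.\<close>

definition lp_ball :: "ennreal \<Rightarrow> (nat \<Rightarrow> 'a::real_normed_vector) set" where
  "lp_ball p = {f. if p = \<infinity> then \<forall>n. norm (f n) \<le> 1
                   else \<forall>N. (\<Sum>n<N. norm (f n) powr enn2real p) \<le> 1}"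

lemma lp_ball_inf: "f \<in> lp_ball \<infinity> \<longleftrightarrow> (\<forall>n. norm (f n) \<le> 1)"
  by (simp add: lp_ball_def)

lemma lp_ball_real:
  "1 \<le> r \<Longrightarrow> f \<in> lp_ball (ennreal r) \<longleftrightarrow> (\<forall>N. (\<Sum>n<N. norm (f n) powr r) \<le> 1)"
  by (simp add: lp_ball_def)

lemma lp_ball_subset_lp_space: "f \<in> lp_ball p \<Longrightarrow> f \<in> lp_space p"
  unfolding lp_ball_def lp_space_def
  by (auto simp: bounded_iff split: if_splits intro!: summableI_nonneg_bounded[of _ 1])

lemma lp_ball_norm_le_1:
  assumes "1 \<le> p" "f \<in> lp_ball p"
  shows "norm (f n) \<le> 1"
  using assms(1)
proof (cases rule: ennreal_ge_1_cases)
  case (2 r)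
  have "norm (f n) powr r \<le> (\<Sum>k<Suc n. norm (f k) powr r)"
    by (rule member_le_sum) auto
  also have "\<dots> \<le> 1" using assms(2) lp_ball_real 2 by blast
  finally have "(norm (f n) powr r) powr (1 / r) \<le> 1 powr (1 / r)"
    using 2 by (intro powr_mono2) auto
  then show ?thesis using 2 by (simp add: powr_powr)
qed (use assms in \<open>simp add: lp_ball_def\<close>)

lemma lp_ball_neg: "f \<in> lp_ball p \<Longrightarrow> (\<lambda>n. - f n) \<in> lp_ball p"
  by (simp add: lp_ball_def)

text \<open>For finite \<open>p\<close>, the triangle inequality and convexity of the p-th power
  take the place of Minkowski's inequality.\<close>

lemma lp_ball_convex:
  assumes p: "1 \<le> p" and fg: "f \<in> lp_ball p" "g \<in> lp_ball p" and uv: "0 \<le> u" "0 \<le> v" "u + v = 1"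
  shows "(\<lambda>n. u *\<^sub>R f n + v *\<^sub>R g n) \<in> lp_ball p"
proof -
  have tri: "norm (u *\<^sub>R f n + v *\<^sub>R g n) \<le> u * norm (f n) + v * norm (g n)" for n
    using norm_triangle_ineq[of "u *\<^sub>R f n" "v *\<^sub>R g n"] uv by simp
  show ?thesis
    using p
  proof (cases rule: ennreal_ge_1_cases)
    case 1
    have "u * norm (f n) + v * norm (g n) \<le> 1" for n
      using convex_bound_le[of "norm (f n)" 1 "norm (g n)" u v] lp_ball_norm_le_1[OF p] fg uv by blast
    then show ?thesis unfolding 1 lp_ball_inf using tri order_trans by blast
  next
    case (2 r)
    have u: "u = 1 - v" using uv by simp
    have pt: "norm (u *\<^sub>R f n + v *\<^sub>R g n) powr r \<le> u * norm (f n) powr r + v * norm (g n) powr r" for n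
    proof -
      have "norm (u *\<^sub>R f n + v *\<^sub>R g n) powr r \<le> (u * norm (f n) + v * norm (g n)) powr r"
        using 2 by (intro powr_mono2 tri) auto
      also have "\<dots> \<le> u * norm (f n) powr r + v * norm (g n) powr r"
        using convex_onD[OF convex_on_powr_nonneg[of r], of v "norm (f n)" "norm (g n)"] 2 uv
        by (simp add: u)
      finally show ?thesis .
    qed
    have "(\<Sum>n<N. norm (u *\<^sub>R f n + v *\<^sub>R g n) powr r) \<le> 1" for N
    proof -
      have "(\<Sum>n<N. norm (u *\<^sub>R f n + v *\<^sub>R g n) powr r)
          \<le> u * (\<Sum>n<N. norm (f n) powr r) + v * (\<Sum>n<N. norm (g n) powr r)"
        using sum_mono[OF pt] by (simp add: sum.distrib sum_distrib_left)
      also have "\<dots> \<le> 1"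
        using fg uv by (intro convex_bound_le) (simp_all add: 2 lp_ball_real)
      finally show ?thesis .
    qed
    then show ?thesis using 2 lp_ball_real by blast
  qed
qed

text \<open>Each partial sum depends continuously on finitely many entries.\<close>

lemma lp_ball_closed:
  assumes p: "1 \<le> p" and F: "\<And>k. F k \<in> lp_ball p" and lim: "\<And>n. (\<lambda>k. F k n) \<longlonglongrightarrow> f n"
  shows "f \<in> lp_ball p"
  using p
proof (cases rule: ennreal_ge_1_cases)
  case 1
  have "norm (f n) \<le> 1" for n
    using tendsto_upperbound[OF tendsto_norm[OF lim[of n]], of 1] lp_ball_norm_le_1[OF p F] by simp
  then show ?thesis unfolding 1 lp_ball_inf by blast
next
  case (2 r)
  have "(\<Sum>n<N. norm (f n) powr r) \<le> 1" for N
  proof (rule tendsto_upperbound)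
    show "(\<lambda>k. \<Sum>n<N. norm (F k n) powr r) \<longlonglongrightarrow> (\<Sum>n<N. norm (f n) powr r)"
      using 2 by (intro tendsto_sum tendsto_powr' tendsto_norm lim tendsto_const) auto
    show "\<forall>\<^sub>F k in sequentially. (\<Sum>n<N. norm (F k n) powr r) \<le> 1"
      using F 2 lp_ball_real by (intro always_eventually) blast
  qed simp
  then show ?thesis using 2 lp_ball_real by blast
qed

text \<open>All entries have norm at most 1, so their powers with exponent at least 1 are no larger
  than the norms themselves.\<close>

lemma lp_ball_of_l1:
  assumes p: "1 \<le> p" and f: "\<And>N. (\<Sum>n<N. norm (f n)) \<le> 1"
  shows "f \<in> lp_ball p"
proof -
  have le1: "norm (f n) \<le> 1" for n
    using member_le_sum[of n "{..<Suc n}" "\<lambda>n. norm (f n)"] f[of "Suc n"] by simp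
  show ?thesis
    using p
  proof (cases rule: ennreal_ge_1_cases)
    case 1
    then show ?thesis using le1 lp_ball_inf by blast
  next
    case (2 r)
    have "norm (f n) powr r \<le> norm (f n)" for n
      using powr_mono'[of 1 r "norm (f n)"] le1[of n] 2 by simp
    then have "(\<Sum>n<N. norm (f n) powr r) \<le> (\<Sum>n<N. norm (f n))" for N
      by (intro sum_mono)
    then show ?thesis using 2 lp_ball_real f order_trans by blast
  qed
qed

text \<open>At most \<open>N\<close> entries are nonzero, and each contributes at most
  \<open>1 / N\<close> to the sum of p-th powers; for infinite \<open>p\<close> the exponent is
  0.\<close>

lemma lp_ball_window:
  assumes p: "1 \<le> p" and f: "\<And>n. norm (f n) \<le> real N powr (- enn2real (inverse p))"
    and supp: "\<And>n. n \<notin> {\<tau>..<\<tau>+N} \<Longrightarrow> f n = 0"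
  shows "f \<in> lp_ball p"
  using p
proof (cases rule: ennreal_ge_1_cases)
  case 1
  have "norm (f n) \<le> 1" for n
    using f[of n] 1 by (simp split: if_splits)
  then show ?thesis unfolding 1 lp_ball_inf by blast
next
  case (2 r)
  have "(\<Sum>n<M. norm (f n) powr r) \<le> 1" for M
  proof -
    have "(\<Sum>n<M. norm (f n) powr r) \<le> (\<Sum>n\<in>{..<M} \<union> {\<tau>..<\<tau>+N}. norm (f n) powr r)"
      by (rule sum_mono2) auto
    also have "\<dots> = (\<Sum>n\<in>{\<tau>..<\<tau>+N}. norm (f n) powr r)"
      by (rule sum.mono_neutral_right) (auto simp: supp)
    also have "\<dots> \<le> (\<Sum>n\<in>{\<tau>..<\<tau>+N}. (real N powr (- (1 / r))) powr r)"
      using f 2 by (intro sum_mono powr_mono2) (auto simp: enn2real_inverse_ennreal)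
    also have "\<dots> \<le> 1"
      using 2 by (cases "N = 0") (simp_all only: powr_powr, simp_all add: powr_minus)
    finally show ?thesis .
  qed
  then show ?thesis using 2 lp_ball_real by blast
qed

section \<open>Inclusions and convolutions of sequence spaces\<close>

text \<open>The terms of a summable series tend to zero, and for norms below 1 a larger exponent
  gives a smaller power.\<close>

lemma lp_space_mono:
  assumes p: "1 \<le> p" "p \<le> q" and v: "v \<in> lp_space p"
  shows "v \<in> lp_space q"
  using p(1)
proof (cases rule: ennreal_ge_1_cases)
  case 1
  then show ?thesis using p v by (simp add: top_unique)
next
  case (2 r)
  then have sm: "summable (\<lambda>n. norm (v n) powr r)" using v by (simp add: lp_space_def)
  then have "(\<lambda>n. (norm (v n) powr r) powr (1 / r)) \<longlonglongrightarrow> 0 powr (1 / r)"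
    using 2 by (intro tendsto_powr' summable_LIMSEQ_zero) auto
  then have lim: "(\<lambda>n. norm (v n)) \<longlonglongrightarrow> 0"
    using 2 by (simp add: powr_powr)
  have "1 \<le> q" using p by simp
  then show ?thesis
  proof (cases rule: ennreal_ge_1_cases)
    case 1
    have "v \<longlonglongrightarrow> 0" using lim by (simp add: tendsto_norm_zero_iff)
    then show ?thesis
      using 1 convergent_imp_bounded by (auto simp: lp_space_def)
  next
    case (2 s)
    have "r \<le> s" using p 2 \<open>p = ennreal r\<close> by simp
    have "\<forall>\<^sub>F n in sequentially. norm (v n) < 1"
      using order_tendstoD(2)[OF lim] by simp
    then have "\<forall>\<^sub>F n in sequentially. norm (norm (v n) powr s) \<le> norm (v n) powr r"
      by eventually_elim (use powr_mono'[OF \<open>r \<le> s\<close>] in simp)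
    then have "summable (\<lambda>n. norm (v n) powr s)"
      using sm by (rule summable_comparison_test_ev)
    then show ?thesis using 2 by (simp add: lp_space_def)
  qed
qed

text \<open>A case of Young's inequality: \<open>v\<close> is the convolution of
  \<open>K * norm (f n)\<close> with a geometric sequence, given by its first-order recursion. For
  infinite \<open>p\<close> the fixed point of the recursion is the bound.\<close>

lemma lp_space_convolution:
  fixes w :: "nat \<Rightarrow> 'a::real_normed_vector" and v :: "nat \<Rightarrow> real"
  assumes p: "1 \<le> p" and f: "f \<in> lp_space p" and \<rho>: "0 \<le> \<rho>" "\<rho> < 1" and K: "0 \<le> K"
    and v: "v 0 = 0" "\<And>n. v (Suc n) = \<rho> * v n + K * norm (f n)"
    and w: "\<And>n. norm (w n) \<le> v n"
  shows "w \<in> lp_space p"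
  using p
proof (cases rule: ennreal_ge_1_cases)
  case 1
  then obtain b where b: "norm (f n) \<le> b" for n
    using f by (auto simp: lp_space_def bounded_iff)
  have "v n \<le> K * b / (1 - \<rho>)" for n
  proof (induction n)
    case 0
    then show ?case using K \<rho> order_trans[OF norm_ge_zero b] v by simp
  next
    case (Suc n)
    have "v (Suc n) \<le> \<rho> * (K * b / (1 - \<rho>)) + K * b"
      unfolding v by (intro add_mono mult_left_mono Suc b K \<rho>)
    also have "\<dots> = K * b / (1 - \<rho>)" using \<rho> by (simp add: field_simps)
    finally show ?case .
  qed
  then have "norm (w n) \<le> K * b / (1 - \<rho>)" for n using w order_trans by blast
  then show ?thesis using 1 by (auto simp: lp_space_def bounded_iff)
next
  case (2 r)
  have v0: "0 \<le> v n" for n using w order_trans[OF norm_ge_zero] by blast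
  have sm: "summable (\<lambda>n. norm (f n) powr r)"
    using f 2 by (simp add: lp_space_def)
  define c where "c = (1 - \<rho>) * (K / (1 - \<rho>)) powr r"
  have c0: "0 \<le> c" using \<rho> by (simp add: c_def)
  define S where "S = (\<Sum>n. norm (f n) powr r)"
  \<comment> \<open>The recursion is a convex combination, with weights \<rho> and
    \<open>1 - \<rho>\<close>, of \<open>v n\<close> and
    \<open>K / (1 - \<rho>) * norm (f n)\<close>.\<close>
  have step: "v (Suc n) powr r \<le> \<rho> * v n powr r + c * norm (f n) powr r" for n
  proof -
    have "v (Suc n) = \<rho> *\<^sub>R v n + (1 - \<rho>) *\<^sub>R (K / (1 - \<rho>) * norm (f n))"
      using v \<rho> by simp
    also have "\<dots> powr r \<le> \<rho> * v n powr r + (1 - \<rho>) * (K / (1 - \<rho>) * norm (f n)) powr r"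
      using convex_onD[OF convex_on_powr_nonneg[of r], of "1 - \<rho>" "v n" "K / (1 - \<rho>) * norm (f n)"]
        \<rho> v0 K 2 by simp
    also have "(K / (1 - \<rho>) * norm (f n)) powr r = (K / (1 - \<rho>)) powr r * norm (f n) powr r"
      by (rule powr_mult)
    finally show ?thesis by (simp add: c_def)
  qed
  \<comment> \<open>Summing the steps bounds the partial sum by \<rho> times itself plus
    \<open>c * S\<close>; as \<open>v 0 = 0\<close>, the index shift loses nothing.\<close>
  have "(\<Sum>n<N. v n powr r) \<le> c * S / (1 - \<rho>)" for N
  proof -
    let ?V = "\<Sum>n<N. v n powr r"
    have "?V \<le> (\<Sum>n<Suc N. v n powr r)" by simp
    also have "\<dots> = (\<Sum>n<N. v (Suc n) powr r)"
      using v by (simp only: sum.lessThan_Suc_shift) simp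
    also have "\<dots> \<le> \<rho> * ?V + c * (\<Sum>n<N. norm (f n) powr r)"
      using sum_mono[OF step] by (simp add: sum.distrib sum_distrib_left)
    also have "\<dots> \<le> \<rho> * ?V + c * S"
      unfolding S_def using sm c0 by (intro add_left_mono mult_left_mono sum_le_suminf) auto
    finally show ?thesis using \<rho> by (simp add: field_simps)
  qed
  then have "summable (\<lambda>n. v n powr r)"
    by (intro summableI_nonneg_bounded) auto
  then have "summable (\<lambda>n. norm (w n) powr r)"
    by (rule summable_comparison_test[rotated]) (use w 2 in \<open>auto intro!: exI[of _ 0] powr_mono2\<close>)
  then show ?thesis using 2 by (simp add: lp_space_def)
qed

section \<open>Elementary inequalities for weights and exponents\<close>

lemma sum_gp_le:
  fixes x :: real
  assumes "0 \<le> x" "x < 1"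
  shows "(\<Sum>i<n. x ^ i) \<le> 1 / (1 - x)"
  using assms by (simp add: sum_gp_strict divide_right_mono)

text \<open>Linear growth is absorbed by the exponential weight, through
  \<open>1 + c * n \<le> exp (c * n)\<close>.\<close>

lemma Suc_mult_exp_le:
  fixes c :: real
  assumes "0 < c"
  shows "real (Suc n) * exp (- c * real n) \<le> 1 + 1 / c"
proof -
  have "real (Suc n) \<le> (1 + 1 / c) * (1 + c * real n)"
    using assms by (simp add: field_simps)
  also have "\<dots> \<le> (1 + 1 / c) * exp (c * real n)"
    using assms by (intro mult_left_mono exp_ge_add_one_self) auto
  finally show ?thesis by (simp add: exp_minus field_simps)
qed

text \<open>Together these place \<open>1 + 1/p - 1/q\<close> in the interval from 1 (included) to 2
  (excluded). The strict bound could fail only for \<open>1/p = 1\<close> and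
  \<open>1/q = 0\<close>.\<close>

lemma enn2real_inverse_exponents:
  assumes "1 \<le> p" "p \<le> q" "(p, q) \<noteq> (1, \<infinity>)"
  shows "enn2real (inverse q) \<le> enn2real (inverse p)"
    and "enn2real (inverse p) < 1 + enn2real (inverse q)"
proof -
  have "enn2real (inverse q) \<le> enn2real (inverse p) \<and> enn2real (inverse p) < 1 + enn2real (inverse q)"
    using assms(1)
  proof (cases rule: ennreal_ge_1_cases)
    case 1
    then show ?thesis using assms(2) by (simp add: top_unique)
  next
    case (2 r)
    have "1 \<le> q" using assms by simp
    then show ?thesis
    proof (cases rule: ennreal_ge_1_cases)
      case 1
      then have "r \<noteq> 1" using assms 2 by auto
      then show ?thesis using 1 2 by (simp add: enn2real_inverse_ennreal)
    next
      case (2 s)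
      then have "r \<le> s" using assms \<open>p = ennreal r\<close> by simp
      then have "1 / s \<le> 1 / r" "1 / r \<le> 1" "0 < 1 / s" using \<open>1 \<le> r\<close> by (auto simp: frac_le)
      then have "1 / s \<le> 1 / r \<and> 1 / r < 1 + 1 / s" by linarith
      then show ?thesis using 2 \<open>p = ennreal r\<close> \<open>1 \<le> r\<close> by (simp add: enn2real_inverse_ennreal)
    qed
  qed
  then show "enn2real (inverse q) \<le> enn2real (inverse p)"
    and "enn2real (inverse p) < 1 + enn2real (inverse q)" by auto
qed

subsection \<open>Solutions and exponential stability\<close>

locale delay_system =
  fixes \<gamma> :: real and L :: "nat \<Rightarrow> (nat \<Rightarrow> 'a::banach) \<Rightarrow> 'a"
  assumes gamma_pos: "0 < \<gamma>"
    and L_bounded: "\<And>n. L n \<in> bounded_operators \<gamma>"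
begin

section \<open>Linearity and superposition\<close>

lemma L_add:
  assumes "\<phi> \<in> phase_space \<gamma>" "\<psi> \<in> phase_space \<gamma>"
  shows "L n (\<lambda>k. \<phi> k + \<psi> k) = L n \<phi> + L n \<psi>"
  using L_bounded[of n] assms by (simp add: bounded_operators_def)

lemma L_scale:
  assumes "\<phi> \<in> phase_space \<gamma>"
  shows "L n (\<lambda>k. c *\<^sub>R \<phi> k) = c *\<^sub>R L n \<phi>"
  using L_bounded[of n] assms by (simp add: bounded_operators_def)

lemma L_zero [simp]: "L n (\<lambda>_. 0) = 0"
  using L_scale[of "\<lambda>_. 0" n 0] by simp

lemma L_diff:
  assumes "\<phi> \<in> phase_space \<gamma>" "\<psi> \<in> phase_space \<gamma>"
  shows "L n (\<lambda>k. \<phi> k - \<psi> k) = L n \<phi> - L n \<psi>"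
  using L_add[OF assms(1) phase_space_scale[OF assms(2), of "-1"], of n] L_scale[OF assms(2), of n "-1"]
  by simp

lemma L_bound: "\<exists>C\<ge>0. \<forall>\<phi>\<in>phase_space \<gamma>. norm (L n \<phi>) \<le> C * phase_norm \<gamma> \<phi>"
proof -
  obtain C where C: "\<And>\<phi>. \<phi> \<in> phase_space \<gamma> \<Longrightarrow> norm (L n \<phi>) \<le> C * phase_norm \<gamma> \<phi>"
    using L_bounded[of n] unfolding bounded_operators_def by blast
  have "norm (L n \<phi>) \<le> max C 0 * phase_norm \<gamma> \<phi>" if "\<phi> \<in> phase_space \<gamma>" for \<phi>
    using order_trans[OF C[OF that] mult_right_mono[OF max.cobounded1 phase_norm_nonneg[OF that]]] .
  then show ?thesis by (intro exI[of _ "max C 0"]) auto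
qed

lemma hist_phase_space: "\<phi> \<in> phase_space \<gamma> \<Longrightarrow> hist L f \<tau> \<phi> k \<in> phase_space \<gamma>"
  by (induction k) (simp_all add: phase_space_case_nat)

lemma hist_superpose:
  assumes "\<phi> \<in> phase_space \<gamma>" "\<psi> \<in> phase_space \<gamma>"
  shows "hist L (\<lambda>n. f n + g n) \<tau> (\<lambda>l. \<phi> l + \<psi> l) k = (\<lambda>l. hist L f \<tau> \<phi> k l + hist L g \<tau> \<psi> k l)"
proof (induction k)
  case (Suc k)
  then show ?case
    by (auto simp: L_add hist_phase_space assms algebra_simps split: nat.splits)
qed simp

lemma hist_scale:
  assumes "\<phi> \<in> phase_space \<gamma>"
  shows "hist L (\<lambda>n. c *\<^sub>R f n) \<tau> (\<lambda>l. c *\<^sub>R \<phi> l) k = (\<lambda>l. c *\<^sub>R hist L f \<tau> \<phi> k l)"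
proof (induction k)
  case (Suc k)
  then show ?case
    by (auto simp: L_scale hist_phase_space assms algebra_simps split: nat.splits)
qed simp

section \<open>Decay in the state space and in the phase space\<close>

lemma phase_norm_hist_Suc:
  assumes "\<phi> \<in> phase_space \<gamma>"
  shows "phase_norm \<gamma> (hist L f \<tau> \<phi> (Suc k))
    \<le> max (norm (hist L f \<tau> \<phi> (Suc k) 0)) (exp (- \<gamma>) * phase_norm \<gamma> (hist L f \<tau> \<phi> k))"
  using phase_norm_case_nat[OF hist_phase_space[OF assms]] by simp

text \<open>The old history contracts by \<open>exp (- \<gamma>) \<le> exp (- \<mu>)\<close> in each
  step, and the new value obeys the assumed bound. The case \<open>\<mu> = 0\<close> serves for
  plain stability.\<close>

lemma phase_norm_hist_le:
  assumes \<phi>: "\<phi> \<in> phase_space \<gamma>" and "0 \<le> \<mu>" "\<mu> \<le> \<gamma>"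
    and K: "phase_norm \<gamma> \<phi> \<le> K"
    and bound: "\<And>k. norm (hist L f \<tau> \<phi> k 0) \<le> K * exp (- \<mu> * real k)"
  shows "phase_norm \<gamma> (hist L f \<tau> \<phi> k) \<le> K * exp (- \<mu> * real k)"
proof (induction k)
  case (Suc k)
  have "0 \<le> K" using K phase_norm_nonneg[OF \<phi>] by linarith
  have "exp (- \<gamma>) * phase_norm \<gamma> (hist L f \<tau> \<phi> k) \<le> exp (- \<mu>) * (K * exp (- \<mu> * real k))"
    using assms \<open>0 \<le> K\<close> by (intro mult_mono Suc phase_norm_nonneg hist_phase_space) auto
  also have "\<dots> = K * exp (- \<mu> * real (Suc k))"
    by (simp add: algebra_simps flip: exp_add)
  finally show ?case
    using phase_norm_hist_Suc[OF \<phi>, of f \<tau> k] bound[of "Suc k"] by linarith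
qed (use K in simp)

text \<open>The initial tuple stays in the history and fades at rate \<gamma>, hence the rate
  \<open>min \<nu> \<gamma>\<close>. Conversely, the newest value is dominated by the norm of the
  history.\<close>

lemma ues_state_iff_ues_phase: "ues_state \<gamma> L \<longleftrightarrow> ues_phase \<gamma> L"
proof
  assume "ues_state \<gamma> L"
  then obtain K \<nu> where K: "1 \<le> K" "0 < \<nu>" and est: "\<And>\<tau> k \<phi>. \<phi> \<in> phase_space \<gamma> \<Longrightarrow>
     norm (hist L (\<lambda>_. 0) \<tau> \<phi> k 0) \<le> K * exp (- \<nu> * real k) * phase_norm \<gamma> \<phi>"
    unfolding ues_state_hist by blast
  have "phase_norm \<gamma> (hist L (\<lambda>_. 0) \<tau> \<phi> k) \<le> K * exp (- min \<nu> \<gamma> * real k) * phase_norm \<gamma> \<phi>"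
    if \<phi>: "\<phi> \<in> phase_space \<gamma>" for \<tau> k \<phi>
  proof -
    have "norm (hist L (\<lambda>_. 0) \<tau> \<phi> k 0) \<le> K * phase_norm \<gamma> \<phi> * exp (- min \<nu> \<gamma> * real k)" for k
    proof -
      have "exp (- \<nu> * real k) \<le> exp (- min \<nu> \<gamma> * real k)"
        by (simp add: mult_right_mono)
      then have "K * phase_norm \<gamma> \<phi> * exp (- \<nu> * real k) \<le> K * phase_norm \<gamma> \<phi> * exp (- min \<nu> \<gamma> * real k)"
        using K phase_norm_nonneg[OF \<phi>] by (intro mult_left_mono) auto
      then show ?thesis using est[OF \<phi>, of \<tau> k] by (simp only: mult_ac)
    qed
    moreover have "phase_norm \<gamma> \<phi> \<le> K * phase_norm \<gamma> \<phi>"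
      using mult_right_mono[OF K(1) phase_norm_nonneg[OF \<phi>]] by simp
    ultimately have "phase_norm \<gamma> (hist L (\<lambda>_. 0) \<tau> \<phi> k)
        \<le> K * phase_norm \<gamma> \<phi> * exp (- min \<nu> \<gamma> * real k)"
      using K gamma_pos by (intro phase_norm_hist_le[OF \<phi>]) auto
    then show ?thesis by (simp only: mult_ac)
  qed
  then show "ues_phase \<gamma> L"
    unfolding ues_phase_hist
    by (intro exI[of _ K] exI[of _ "min \<nu> \<gamma>"] conjI) (use K gamma_pos in auto)
next
  assume "ues_phase \<gamma> L"
  then show "ues_state \<gamma> L"
    unfolding ues_phase_hist ues_state_hist
    by (meson order_trans phase_norm_ge_head hist_phase_space)
qed

section \<open>From exponential stability to stability under forcing\<close>

text \<open>Variation of constants: the first forcing value acts as an initial tuple one step later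
  and evolves homogeneously, while the remaining values force a solution from zero.\<close>

lemma hist_forced_bound:
  assumes K: "0 \<le> K" and est: "\<And>\<tau> k \<phi>. \<phi> \<in> phase_space \<gamma> \<Longrightarrow>
     phase_norm \<gamma> (hist L (\<lambda>_. 0) \<tau> \<phi> k) \<le> K * \<rho> ^ k * phase_norm \<gamma> \<phi>"
    and \<rho>: "0 \<le> \<rho>"
  shows "phase_norm \<gamma> (hist L f \<tau> (\<lambda>_. 0) n) \<le> (\<Sum>k<n. K * \<rho> ^ (n - Suc k) * norm (f (\<tau> + k)))"
proof (induction n arbitrary: \<tau>)
  case (Suc n)
  let ?E = "case_nat (f \<tau>) (\<lambda>_. 0)"
  have E: "?E \<in> phase_space \<gamma>" by (rule phase_space_case_nat) simp
  have nE: "phase_norm \<gamma> ?E \<le> norm (f \<tau>)"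
    using phase_norm_case_nat[of "\<lambda>_. 0" \<gamma> "f \<tau>"] by simp
  have "hist L f \<tau> (\<lambda>_. 0) (Suc n) = hist L f (Suc \<tau>) ?E n"
    using hist_add[of L f \<tau> "\<lambda>_. 0" "Suc 0" n] by simp
  also have "\<dots> = (\<lambda>l. hist L f (Suc \<tau>) (\<lambda>_. 0) n l + hist L (\<lambda>_. 0) (Suc \<tau>) ?E n l)"
    using hist_superpose[of "\<lambda>_. 0" ?E f "\<lambda>_. 0" "Suc \<tau>" n] E by simp
  finally have "phase_norm \<gamma> (hist L f \<tau> (\<lambda>_. 0) (Suc n))
      = phase_norm \<gamma> (\<lambda>l. hist L f (Suc \<tau>) (\<lambda>_. 0) n l + hist L (\<lambda>_. 0) (Suc \<tau>) ?E n l)"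
    by (rule arg_cong)
  also have "\<dots> \<le> phase_norm \<gamma> (hist L f (Suc \<tau>) (\<lambda>_. 0) n)
      + phase_norm \<gamma> (hist L (\<lambda>_. 0) (Suc \<tau>) ?E n)"
    by (intro phase_norm_add hist_phase_space E phase_space_zero)
  also have "\<dots> \<le> (\<Sum>k<n. K * \<rho> ^ (n - Suc k) * norm (f (Suc \<tau> + k))) + K * \<rho> ^ n * norm (f \<tau>)"
  proof (rule add_mono[OF Suc.IH[of "Suc \<tau>"]])
    have "phase_norm \<gamma> (hist L (\<lambda>_. 0) (Suc \<tau>) ?E n) \<le> K * \<rho> ^ n * phase_norm \<gamma> ?E"
      by (rule est[OF E])
    also have "\<dots> \<le> K * \<rho> ^ n * norm (f \<tau>)"
      using K \<rho> by (intro mult_left_mono nE) auto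
    finally show "phase_norm \<gamma> (hist L (\<lambda>_. 0) (Suc \<tau>) ?E n) \<le> K * \<rho> ^ n * norm (f \<tau>)" .
  qed
  also have "\<dots> = (\<Sum>k<Suc n. K * \<rho> ^ (Suc n - Suc k) * norm (f (\<tau> + k)))"
    by (simp only: sum.lessThan_Suc_shift) simp
  finally show ?case .
qed simp

text \<open>The forced solution is dominated by a geometric convolution, so it lies in the p-space
  and then in the q-space. The operators are bounded by \<open>K\<close> because
  \<open>L n \<phi>\<close> is the newest value after one step; \<open>proj_upto 0\<close> is the
  identity.\<close>

lemma ues_phase_imp_stable:
  assumes "ues_phase \<gamma> L" and p: "1 \<le> p" "p \<le> q"
  shows "lp_lq_stable L p q"
    and "bdd_above (range (\<lambda>n. operator_norm \<gamma> (L n \<circ> proj_upto 0)))"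
proof -
  obtain K \<nu> where K: "1 \<le> K" "0 < \<nu>" and est: "\<And>\<tau> k \<phi>. \<phi> \<in> phase_space \<gamma> \<Longrightarrow>
     phase_norm \<gamma> (hist L (\<lambda>_. 0) \<tau> \<phi> k) \<le> K * exp (- \<nu> * real k) * phase_norm \<gamma> \<phi>"
    using assms(1) unfolding ues_phase_hist by blast
  define \<rho> where "\<rho> = exp (- \<nu>)"
  have \<rho>: "0 \<le> \<rho>" "\<rho> < 1" using K by (simp_all add: \<rho>_def)
  have est': "phase_norm \<gamma> (hist L (\<lambda>_. 0) \<tau> \<phi> k) \<le> K * \<rho> ^ k * phase_norm \<gamma> \<phi>"
    if "\<phi> \<in> phase_space \<gamma>" for \<tau> k \<phi>
    using est[OF that, of \<tau> k] by (simp add: \<rho>_def mult.commute flip: exp_of_nat_mult)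
  show "lp_lq_stable L p q"
    unfolding lp_lq_stable_def
  proof
    fix f :: "nat \<Rightarrow> 'a" assume f: "f \<in> lp_space p"
    define v where "v n = (\<Sum>k<n. K * \<rho> ^ (n - Suc k) * norm (f k))" for n
    have "(\<lambda>n. hist L f 0 (\<lambda>_. 0) n 0) \<in> lp_space p"
    proof (rule lp_space_convolution[OF p(1) f \<rho>, of K v])
      show "v (Suc n) = \<rho> * v n + K * norm (f n)" for n
      proof -
        have "(\<Sum>k<n. K * \<rho> ^ (n - k) * norm (f k)) = \<rho> * v n"
          unfolding v_def sum_distrib_left
        proof (rule sum.cong[OF refl])
          fix k assume "k \<in> {..<n}"
          then have "n - k = Suc (n - Suc k)" by auto
          then show "K * \<rho> ^ (n - k) * norm (f k) = \<rho> * (K * \<rho> ^ (n - Suc k) * norm (f k))"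
            by simp
        qed
        then show ?thesis by (simp add: v_def)
      qed
      show "norm (hist L f 0 (\<lambda>_. 0) n 0) \<le> v n" for n
      proof -
        have "norm (hist L f 0 (\<lambda>_. 0) n 0) \<le> phase_norm \<gamma> (hist L f 0 (\<lambda>_. 0) n)"
          by (intro phase_norm_ge_head hist_phase_space phase_space_zero)
        also have "\<dots> \<le> (\<Sum>k<n. K * \<rho> ^ (n - Suc k) * norm (f (0 + k)))"
          by (rule hist_forced_bound) (use K est' \<rho> in auto)
        finally show ?thesis by (simp add: v_def)
      qed
    qed (use K in \<open>simp_all add: v_def\<close>)
    then show "(\<lambda>n. solution L f 0 (\<lambda>_. 0) (int n)) \<in> lp_space q"
      unfolding solution_zero_eq_hist by (rule lp_space_mono[OF p])
  qed
  have "norm (L n \<phi>) \<le> K * phase_norm \<gamma> \<phi>" if \<phi>: "\<phi> \<in> phase_space \<gamma>" for n \<phi>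
  proof -
    have "norm (L n \<phi>) \<le> phase_norm \<gamma> (hist L (\<lambda>_. 0) n \<phi> (Suc 0))"
      using phase_norm_ge_head[OF hist_phase_space[OF \<phi>], of "\<lambda>_. 0" n "Suc 0"] by simp
    also have "\<dots> \<le> K * \<rho> * phase_norm \<gamma> \<phi>"
      using est'[OF \<phi>, of n "Suc 0"] by simp
    also have "\<dots> \<le> K * 1 * phase_norm \<gamma> \<phi>"
      using K \<rho> phase_norm_nonneg[OF \<phi>] by (intro mult_mono) auto
    finally show ?thesis by simp
  qed
  then have "operator_norm \<gamma> (L n \<circ> proj_upto 0) \<le> K" for n
    using K by (intro operator_norm_le) (auto simp: proj_upto_def)
  then show "bdd_above (range (\<lambda>n. operator_norm \<gamma> (L n \<circ> proj_upto 0)))"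
    by (intro bdd_aboveI2)
qed

subsection \<open>From stability of the forced system to exponential stability\<close>

text \<open>Uniform boundedness for the normalised window sums, indexed by the pairs of \<tau> and
  \<open>N\<close>; stability bounds them for each fixed forcing.\<close>

lemma lp_lq_stable_window_bound:
  assumes stable: "lp_lq_stable L p q" and p: "1 \<le> p" and q: "1 \<le> q"
  shows "\<exists>C. \<forall>\<tau> N. \<forall>f\<in>lp_ball p. real N powr (enn2real (inverse q) - 1)
    * (\<Sum>n\<in>{\<tau><..\<tau>+N}. norm (hist L f 0 (\<lambda>_. 0) n 0)) \<le> C"
proof -
  define T where "T i f = real (snd i) powr (enn2real (inverse q) - 1)
    * (\<Sum>n\<in>{fst i<..fst i+snd i}. norm (hist L f 0 (\<lambda>_. 0) n 0))" for i :: "nat \<times> nat" and f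
  have "\<exists>C. \<forall>i. \<forall>f\<in>lp_ball p. T i f \<le> C"
  proof (rule uniform_boundedness_sequence_ball)
    show "lp_ball p \<noteq> ({} :: (nat \<Rightarrow> 'a) set)"
      using lp_ball_of_l1[OF p, of "\<lambda>_. 0 :: 'a"] by auto
    show "T i (\<lambda>n. f n + g n) \<le> T i f + T i g" for i f g
    proof -
      have "hist L (\<lambda>n. f n + g n) 0 (\<lambda>_. 0) n 0 = hist L f 0 (\<lambda>_. 0) n 0 + hist L g 0 (\<lambda>_. 0) n 0" for n
        using hist_superpose[of "\<lambda>_. 0" "\<lambda>_. 0" f g 0 n] by simp
      then show ?thesis
        unfolding T_def distrib_left[symmetric] sum.distrib[symmetric]
        by (intro mult_left_mono sum_mono) (simp_all add: norm_triangle_ineq)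
    qed
    show "T i (\<lambda>n. c *\<^sub>R f n) = \<bar>c\<bar> * T i f" for i c f
    proof -
      have "hist L (\<lambda>n. c *\<^sub>R f n) 0 (\<lambda>_. 0) n 0 = c *\<^sub>R hist L f 0 (\<lambda>_. 0) n 0" for n
        using hist_scale[of "\<lambda>_. 0" c f 0 n] by simp
      then show ?thesis by (simp add: T_def sum_distrib_left mult_ac)
    qed
    show "\<exists>c. \<forall>f\<in>lp_ball p. T i f \<le> c" for i
    proof -
      \<comment> \<open>The bound may depend on \<open>n\<close>, since only the individual
        operators \<open>L n\<close> are known to be bounded here.\<close>
      have "\<exists>d. \<forall>f\<in>lp_ball p. phase_norm \<gamma> (hist L f 0 (\<lambda>_. 0) n) \<le> d" for n
      proof (induction n)
        case (Suc n)
        then obtain d where d: "phase_norm \<gamma> (hist L f 0 (\<lambda>_. 0) n) \<le> d" if "f \<in> lp_ball p" for f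
          by auto
        obtain C where C: "0 \<le> C" "norm (L n \<phi>) \<le> C * phase_norm \<gamma> \<phi>" if "\<phi> \<in> phase_space \<gamma>" for \<phi>
          using L_bound by blast
        have C0: "0 \<le> C" using C(1) phase_space_zero by blast
        have "phase_norm \<gamma> (hist L f 0 (\<lambda>_. 0) (Suc n)) \<le> max (C * d + 1) d" if f: "f \<in> lp_ball p" for f
        proof -
          let ?h = "hist L f 0 (\<lambda>_. 0) n"
          have h: "?h \<in> phase_space \<gamma>" by (simp add: hist_phase_space)
          have "norm (L n ?h) \<le> C * d"
            using order_trans[OF C(2)[OF h] mult_left_mono[OF d[OF f] C0]] .
          then have "norm (hist L f 0 (\<lambda>_. 0) (Suc n) 0) \<le> C * d + 1"
            using norm_triangle_ineq[of "L n ?h" "f n"] lp_ball_norm_le_1[OF p f, of n] by simp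
          moreover have "exp (- \<gamma>) * phase_norm \<gamma> ?h \<le> 1 * d"
            using gamma_pos d[OF f] phase_norm_nonneg[OF h] by (intro mult_mono) auto
          ultimately show ?thesis
            using phase_norm_hist_Suc[OF phase_space_zero, of f 0 n] by auto
        qed
        then show ?case by blast
      qed auto
      then obtain d where d: "phase_norm \<gamma> (hist L f 0 (\<lambda>_. 0) n) \<le> d n" if "f \<in> lp_ball p" for f n
        by metis
      have "norm (hist L f 0 (\<lambda>_. 0) n 0) \<le> d n" if "f \<in> lp_ball p" for f n
        using order_trans[OF phase_norm_ge_head[OF hist_phase_space[OF phase_space_zero]] d[OF that]] .
      then have "T i f \<le> real (snd i) powr (enn2real (inverse q) - 1) * (\<Sum>n\<in>{fst i<..fst i+snd i}. d n)"
        if "f \<in> lp_ball p" for f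
        unfolding T_def using that by (intro mult_left_mono sum_mono) auto
      then show ?thesis by blast
    qed
    show "\<exists>C. \<forall>i. T i f \<le> C" if "f \<in> lp_ball p" for f
    proof -
      have "(\<lambda>n. hist L f 0 (\<lambda>_. 0) n 0) \<in> lp_space q"
        using stable lp_ball_subset_lp_space[OF that]
        unfolding lp_lq_stable_def solution_zero_eq_hist by blast
      from lp_space_window_sum[OF q this] show ?thesis
        unfolding T_def by (metis)
    qed
  qed (use lp_ball_norm_le_1[OF p] lp_ball_neg lp_ball_convex[OF p] lp_ball_closed[OF p] in blast)+
  then show ?thesis unfolding T_def by simp
qed

text \<open>A forcing of 1-norm \<open>A\<close> lies in \<open>A\<close> times every p-ball, and a
  window of length 1 isolates one value. A forcing bounded by \<open>A\<close> on \<open>N\<close>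
  instants has p-norm at most \<open>A * N powr (1/p)\<close>, which joins the factor
  \<open>N powr (1 - 1/q)\<close>.\<close>

lemma path_bounds:
  assumes stable: "lp_lq_stable L p q" and p: "1 \<le> p" and q: "1 \<le> q"
  obtains C where "0 < C"
    and "\<And>w J A n. w 0 = 0 \<Longrightarrow> (\<Sum>j<J. norm (w (Suc j) - L j (padded w j))) \<le> A \<Longrightarrow> n \<le> J
      \<Longrightarrow> norm (w n) \<le> C * A"
    and "\<And>w \<tau> N A. w 0 = 0 \<Longrightarrow> \<forall>j<\<tau>. w (Suc j) - L j (padded w j) = 0
      \<Longrightarrow> \<forall>j. norm (w (Suc j) - L j (padded w j)) \<le> A
      \<Longrightarrow> (\<Sum>n\<in>{\<tau><..\<tau>+N}. norm (w n))
        \<le> C * A * real N powr (1 + enn2real (inverse p) - enn2real (inverse q))"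
proof -
  let ?a = "enn2real (inverse p)" and ?b = "enn2real (inverse q)"
  obtain C0 where C0: "real N powr (?b - 1) * (\<Sum>n\<in>{\<tau><..\<tau>+N}. norm (hist L f 0 (\<lambda>_. 0) n 0)) \<le> C0"
    if "f \<in> lp_ball p" for \<tau> N f
    using lp_lq_stable_window_bound[OF assms] by blast
  define C where "C = max C0 1"
  have C: "0 < C" by (simp add: C_def)
  \<comment> \<open>Scaling into the unit ball divides by the bound, which may be 0; a slightly
    larger \<open>a\<close> is used instead and then lowered to \<open>A\<close>.\<close>
  have limit: "t \<le> C * A" if "\<And>a. A < a \<Longrightarrow> t \<le> C * a" for t A
  proof -
    have "t / C \<le> A" by (rule dense_ge) (use that C in \<open>simp add: field_simps\<close>)
    then show ?thesis using C by (simp add: field_simps)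
  qed
  \<comment> \<open>The forcing is cut off at \<open>J\<close> to fit into the ball; by causality
    the path is unchanged on the window.\<close>
  have path: "real N powr (?b - 1) * (\<Sum>n\<in>{\<tau><..\<tau>+N}. norm (w n)) \<le> C * a"
    if "w 0 = 0" "0 < a" "\<tau> + N \<le> J"
      and "(\<lambda>j. (1 / a) *\<^sub>R (if j < J then w (Suc j) - L j (padded w j) else 0)) \<in> lp_ball p"
    for w a J \<tau> N
  proof -
    let ?f = "\<lambda>j. if j < J then w (Suc j) - L j (padded w j) else 0"
    have w: "hist L (\<lambda>j. (1 / a) *\<^sub>R ?f j) 0 (\<lambda>_. 0) n 0 = (1 / a) *\<^sub>R w n" if "n \<le> J" for n
    proof -
      have "hist L (\<lambda>j. (1 / a) *\<^sub>R ?f j) 0 (\<lambda>_. 0) n 0 = (1 / a) *\<^sub>R hist L ?f 0 (\<lambda>_. 0) n 0"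
        using hist_scale[of "\<lambda>_. 0" "1 / a" ?f 0 n] by simp
      also have "hist L ?f 0 (\<lambda>_. 0) n = hist L (\<lambda>j. w (Suc j) - L j (padded w j)) 0 (\<lambda>_. 0) n"
        by (rule hist_cong) (use that in auto)
      also have "\<dots> = padded w n" by (intro hist_padded \<open>w 0 = 0\<close>)
      finally show ?thesis by (simp add: padded_def)
    qed
    have "(\<Sum>n\<in>{\<tau><..\<tau>+N}. norm (hist L (\<lambda>j. (1 / a) *\<^sub>R ?f j) 0 (\<lambda>_. 0) n 0))
        = (\<Sum>n\<in>{\<tau><..\<tau>+N}. norm (w n)) / a"
      unfolding sum_divide_distrib using that by (intro sum.cong) (simp_all add: w)
    then have "real N powr (?b - 1) * ((\<Sum>n\<in>{\<tau><..\<tau>+N}. norm (w n)) / a) \<le> C"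
      using C0[OF that(4), of N \<tau>] by (simp add: C_def)
    then show ?thesis using that by (simp add: field_simps)
  qed
  show ?thesis
  proof (rule that[OF C])
    fix w :: "nat \<Rightarrow> 'a" and J A n
    let ?f = "\<lambda>j. w (Suc j) - L j (padded w j)"
    assume w0: "w 0 = 0" and A: "(\<Sum>j<J. norm (?f j)) \<le> A" and n: "n \<le> J"
    show "norm (w n) \<le> C * A"
    proof (rule limit)
      fix a assume "A < a"
      have a: "0 < a" using sum_nonneg[of "{..<J}" "\<lambda>j. norm (?f j)"] A \<open>A < a\<close> by simp
      show "norm (w n) \<le> C * a"
      proof (cases n)
        case 0
        then show ?thesis using w0 a C by simp
      next
        case (Suc k)
        have "real 1 powr (?b - 1) * (\<Sum>n\<in>{k<..k+1}. norm (w n)) \<le> C * a"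
        proof (rule path[where w = w and J = J])
          show "(\<lambda>j. (1 / a) *\<^sub>R (if j < J then ?f j else 0)) \<in> lp_ball p"
          proof (rule lp_ball_of_l1[OF p])
            fix N
            have "(\<Sum>j<N. norm ((1 / a) *\<^sub>R (if j < J then ?f j else 0)))
                = (\<Sum>j<N. if j < J then norm (?f j) else 0) / a"
              unfolding sum_divide_distrib by (rule sum.cong) (use a in auto)
            also have "(\<Sum>j<N. if j < J then norm (?f j) else 0) = (\<Sum>j\<in>{..<N} \<inter> {j. j < J}. norm (?f j))"
              by (simp add: sum.If_cases)
            also have "\<dots> \<le> (\<Sum>j<J. norm (?f j))" by (rule sum_mono2) auto
            also have "\<dots> \<le> a" using A \<open>A < a\<close> by simp
            finally show "(\<Sum>j<N. norm ((1 / a) *\<^sub>R (if j < J then ?f j else 0))) \<le> 1"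
              using a by (simp add: divide_right_mono)
          qed
        qed (use w0 a n Suc in auto)
        moreover have "{k<..k+1} = {n}" using Suc by auto
        ultimately show ?thesis by simp
      qed
    qed
  next
    fix w :: "nat \<Rightarrow> 'a" and \<tau> N A
    let ?f = "\<lambda>j. w (Suc j) - L j (padded w j)"
    assume w0: "w 0 = 0" and f0': "\<forall>j<\<tau>. ?f j = 0" and A': "\<forall>j. norm (?f j) \<le> A"
    have f0: "?f j = 0" if "j < \<tau>" for j using f0' that by blast
    have A: "norm (?f j) \<le> A" for j using A' by blast
    let ?S = "\<Sum>n\<in>{\<tau><..\<tau>+N}. norm (w n)"
    show "?S \<le> C * A * real N powr (1 + ?a - ?b)"
    proof (cases "N = 0")
      case False
      then have N: "0 < real N" by simp
      have "real N powr (?b - 1 - ?a) * ?S \<le> C * A"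
      proof (rule limit)
        fix a assume "A < a"
        then have a: "0 < a" using order_trans[OF norm_ge_zero A] by (meson le_less_trans)
        have "real N powr (?b - 1) * ?S \<le> C * (a * real N powr ?a)"
        proof (rule path[where w = w and J = "\<tau> + N"])
          show "(\<lambda>j. (1 / (a * real N powr ?a)) *\<^sub>R (if j < \<tau> + N then ?f j else 0)) \<in> lp_ball p"
          proof (rule lp_ball_window[OF p])
            fix j
            have "norm (if j < \<tau> + N then ?f j else 0) \<le> a"
              using A[of j] \<open>A < a\<close> a by auto
            then show "norm ((1 / (a * real N powr ?a)) *\<^sub>R (if j < \<tau> + N then ?f j else 0)) \<le> real N powr - ?a"
              using a N by (simp add: powr_minus field_simps)
          next
            fix j assume "j \<notin> {\<tau>..<\<tau> + N}"
            then show "(1 / (a * real N powr ?a)) *\<^sub>R (if j < \<tau> + N then ?f j else 0) = 0"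
              using f0[of j] by auto
          qed
        qed (use w0 a N in auto)
        then have "real N powr (- ?a) * (real N powr (?b - 1) * ?S)
            \<le> real N powr (- ?a) * (C * (a * real N powr ?a))"
          by (rule mult_left_mono) simp
        then show "real N powr (?b - 1 - ?a) * ?S \<le> C * a"
          using N by (simp add: powr_minus powr_diff powr_add field_simps)
      qed
      then have "real N powr (1 + ?a - ?b) * (real N powr (?b - 1 - ?a) * ?S) \<le> real N powr (1 + ?a - ?b) * (C * A)"
        by (rule mult_left_mono) simp
      moreover have "real N powr (1 + ?a - ?b) * real N powr (?b - 1 - ?a) = 1"
        using N by (simp flip: powr_add)
      ultimately show ?thesis
        unfolding mult.assoc[symmetric] by (simp add: mult.commute mult.left_commute)
    qed simp
  qed
qed

section \<open>Uniform boundedness of the operators\<close>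

text \<open>
  Prescribing a path that equals \<open>v\<close> at one instant and zero at the following \<open>k\<close> instants isolates
  the action of \<^term>\<open>L n\<close> on the coordinate \<open>k\<close>, and the forcing term of the path only involves
  the action on the coordinates below \<open>k\<close>.
\<close>

lemma single_coordinate_bound:
  assumes "lp_lq_stable L p q" and "1 \<le> p" and "1 \<le> q"
  shows "\<exists>c\<ge>0. \<forall>n v. norm (L n (\<lambda>i. if i = k then v else 0)) \<le> c * norm v"
proof (induction k rule: less_induct)
  case (less k)
  let ?e = "\<lambda>k v i. if i = (k::nat) then v :: 'a else 0"
  obtain C where C: "0 < C" and path: "\<And>w J A n. w 0 = 0 \<Longrightarrow>
      (\<Sum>j<J. norm (w (Suc j) - L j (padded w j))) \<le> A \<Longrightarrow> n \<le> J \<Longrightarrow> norm (w n) \<le> C * A"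
    by (rule path_bounds[OF assms]) (rule that)
  obtain c where c: "i < k \<Longrightarrow> 0 \<le> c i" "i < k \<Longrightarrow> norm (L n (?e i v)) \<le> c i * norm v" for i n v
    using less.IH by metis
  obtain b where b: "0 \<le> b n" "\<phi> \<in> phase_space \<gamma> \<Longrightarrow> norm (L n \<phi>) \<le> b n * phase_norm \<gamma> \<phi>" for n \<phi>
    using L_bound by metis
  define c' where "c' = (\<Sum>i<k. c i)"
  have c'0: "0 \<le> c'" unfolding c'_def using c by (intro sum_nonneg) auto
  have cc': "c i \<le> c'" if "i < k" for i
    unfolding c'_def by (rule member_le_sum) (use c that in auto)
  \<comment> \<open>The first summand serves the finitely many \<open>n \<le> k\<close>, for which
    the pulse at time \<open>n - k\<close> would not come after time 0. In the second,
    \<open>Suc (Suc k)\<close> counts the instants from \<open>t\<close> to \<open>n\<close> at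
    which forcing may occur.\<close>
  define d where "d = (\<Sum>n\<le>k. b n) + C * (real (Suc (Suc k)) * (1 + c'))"
  have b_le: "b n \<le> (\<Sum>n\<le>k. b n)" if "n \<le> k" for n
    by (rule member_le_sum) (use b that in auto)
  have sum_b: "0 \<le> (\<Sum>n\<le>k. b n)" using b by (intro sum_nonneg) auto
  have "norm (L n (?e k v)) \<le> d * norm v" for n v
  proof (cases "n \<le> k")
    case True
    have "phase_norm \<gamma> (?e k v) \<le> norm v"
      by (rule phase_norm_le) (use gamma_pos in \<open>auto simp: mult_left_le\<close>)
    then have "norm (L n (?e k v)) \<le> b n * norm v"
      using b(2)[OF phase_space_single, of n k v] mult_left_mono[OF _ b(1)] by (meson order_trans)
    also have "\<dots> \<le> d * norm v"
    proof (rule mult_right_mono)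
      have "0 \<le> C * (real (Suc (Suc k)) * (1 + c'))" using C c'0 by simp
      then show "b n \<le> d" using b_le[OF True] unfolding d_def by linarith
    qed simp
    finally show ?thesis .
  next
    case False
    then obtain t where n: "n = Suc t + k" using less_imp_Suc_add[of k n] by (auto simp: algebra_simps)
    \<comment> \<open>The pulse sits at \<open>n - k = Suc t\<close>. The value at
      \<open>Suc n\<close> is chosen so that the forcing at \<open>n\<close> vanishes; it is the
      quantity to be estimated.\<close>
    define w where "w j = (if j = Suc t then v else if j = Suc n then L n (?e k v) else 0)" for j
    let ?f = "\<lambda>j. w (Suc j) - L j (padded w j)"
    have w0: "w 0 = 0" by (simp add: w_def)
    have pad: "padded w j = (if t < j then ?e (j - Suc t) v else (\<lambda>_. 0))" if "j \<le> n" for j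
      using that by (auto simp: padded_def w_def fun_eq_iff)
    have f0: "?f j = 0" if "j < t" for j
      using that n by (simp add: pad) (simp add: w_def)
    have f_le: "norm (?f j) \<le> (1 + c') * norm v" if "j \<le> n" for j
    proof -
      consider "j < t" | "j = t" | "t < j" "j < n" | "j = n"
        using \<open>j \<le> n\<close> by linarith
      then show ?thesis
      proof cases
        case 1
        then show ?thesis using f0 c'0 by simp
      next
        case 2
        then show ?thesis using c'0 n by (simp add: pad w_def distrib_right)
      next
        case 3
        have "norm (?f j) = norm (L j (?e (j - Suc t) v))" using 3 by (simp add: pad) (simp add: w_def)
        also have "\<dots> \<le> c (j - Suc t) * norm v" using 3 n by (intro c) auto
        also have "\<dots> \<le> (1 + c') * norm v"
        proof (rule mult_right_mono)
          have "j - Suc t < k" using 3 n by linarith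
          from cc'[OF this] show "c (j - Suc t) \<le> 1 + c'" by simp
        qed simp
        finally show ?thesis .
      next
        case 4
        then show ?thesis using n c'0 by (simp add: pad) (simp add: w_def)
      qed
    qed
    have "(\<Sum>j<Suc n. norm (?f j)) = (\<Sum>j\<in>{t..n}. norm (?f j))"
      by (rule sum.mono_neutral_right) (use f0 in auto)
    also have "\<dots> \<le> real (card {t..n}) * ((1 + c') * norm v)"
      by (rule sum_bounded_above) (use f_le in auto)
    finally have "norm (w (Suc n)) \<le> C * (real (card {t..n}) * ((1 + c') * norm v))"
      using w0 by (intro path[where w = w and J = "Suc n"]) simp_all
    then have "norm (L n (?e k v)) \<le> C * (real (Suc (Suc k)) * (1 + c')) * norm v"
      by (simp add: w_def n mult.assoc)
    also have "\<dots> \<le> d * norm v"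
      using sum_b by (intro mult_right_mono) (auto simp: d_def)
    finally show ?thesis .
  qed
  moreover have "0 \<le> d" using C c'0 sum_b by (simp add: d_def)
  ultimately show ?case by blast
qed

text \<open>A tuple splits into its part with index at most \<open>m\<close>, covered by the
  hypothesis, and finitely many single coordinates.\<close>

lemma uniformly_bounded_operators:
  assumes stable: "lp_lq_stable L p q" and "1 \<le> p" and "1 \<le> q"
    and m: "bdd_above (range (\<lambda>n. operator_norm \<gamma> (L n \<circ> proj_upto m)))"
  shows "\<exists>M\<ge>0. \<forall>n. \<forall>\<phi>\<in>phase_space \<gamma>. norm (L n \<phi>) \<le> M * phase_norm \<gamma> \<phi>"
proof -
  let ?e = "\<lambda>k v i. if i = (k::nat) then v :: 'a else 0"
  obtain c where c: "0 \<le> c i" "norm (L n (?e i v)) \<le> c i * norm v" for i n v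
    using single_coordinate_bound[OF assms(1-3)] by metis
  obtain M0 where M0: "operator_norm \<gamma> (L n \<circ> proj_upto m) \<le> M0" for n
    using m by (auto simp: bdd_above_def)
  define K where "K = nat (- m)"
  \<comment> \<open>The factor \<open>exp (\<gamma> * real i)\<close> undoes the weight of
    coordinate \<open>i\<close> in the phase norm.\<close>
  define M where "M = max M0 0 + (\<Sum>i<K. c i * exp (\<gamma> * real i))"
  have head_space: "(\<lambda>l. if l < j then \<phi> l else 0) \<in> phase_space \<gamma>" for j and \<phi> :: "nat \<Rightarrow> 'a"
    by (rule phase_space_finite_support[of j]) auto
  have "norm (L n \<phi>) \<le> M * phase_norm \<gamma> \<phi>" if \<phi>: "\<phi> \<in> phase_space \<gamma>" for n \<phi>
  proof -
    have head: "norm (L n (\<lambda>l. if l < j then \<phi> l else 0)) \<le> (\<Sum>i<j. c i * exp (\<gamma> * real i)) * phase_norm \<gamma> \<phi>" for j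
    proof (induction j)
      case (Suc j)
      have "(\<lambda>l. if l < Suc j then \<phi> l else 0) = (\<lambda>l. (if l < j then \<phi> l else 0) + ?e j (\<phi> j) l)"
        by (auto simp: fun_eq_iff less_Suc_eq)
      then have "L n (\<lambda>l. if l < Suc j then \<phi> l else 0) = L n (\<lambda>l. if l < j then \<phi> l else 0) + L n (?e j (\<phi> j))"
        by (simp only: L_add[OF head_space phase_space_single])
      moreover have "norm (L n (?e j (\<phi> j))) \<le> c j * (exp (\<gamma> * real j) * phase_norm \<gamma> \<phi>)"
      proof (rule order_trans[OF c(2)])
        show "c j * norm (\<phi> j) \<le> c j * (exp (\<gamma> * real j) * phase_norm \<gamma> \<phi>)"
          using phase_coord_le[OF \<phi>, of j] by (intro mult_left_mono c) (simp add: exp_minus field_simps)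
      qed
      ultimately show ?case
        using norm_triangle_mono[OF Suc] by (simp add: distrib_right mult.assoc)
    qed simp
    have proj: "proj_upto m \<psi> = (\<lambda>l. if K \<le> l then \<psi> l else 0)" for \<psi> :: "nat \<Rightarrow> 'a"
      by (auto simp: proj_upto_def K_def fun_eq_iff)
    have proj_space: "proj_upto m \<psi> \<in> phase_space \<gamma>"
      and proj_norm: "phase_norm \<gamma> (proj_upto m \<psi>) \<le> phase_norm \<gamma> \<psi>"
      if \<psi>: "\<psi> \<in> phase_space \<gamma>" for \<psi> :: "nat \<Rightarrow> 'a"
    proof -
      have "norm (proj_upto m \<psi> l) * exp (- \<gamma> * real l) \<le> phase_norm \<gamma> \<psi>" for l
        using phase_coord_le[OF \<psi>, of l] phase_norm_nonneg[OF \<psi>] by (simp add: proj_upto_def)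
      then show "proj_upto m \<psi> \<in> phase_space \<gamma>" "phase_norm \<gamma> (proj_upto m \<psi>) \<le> phase_norm \<gamma> \<psi>"
        by (rule phase_spaceI, rule phase_norm_le)
    qed
    obtain C where C: "0 \<le> C" "\<And>\<psi>. \<psi> \<in> phase_space \<gamma> \<Longrightarrow> norm (L n \<psi>) \<le> C * phase_norm \<gamma> \<psi>"
      using L_bound by metis
    have "norm ((L n \<circ> proj_upto m) \<phi>) \<le> operator_norm \<gamma> (L n \<circ> proj_upto m) * phase_norm \<gamma> \<phi>"
    proof (rule bounded_operator_le_operator_norm[OF _ \<phi>])
      fix \<psi> :: "nat \<Rightarrow> 'a" assume \<psi>: "\<psi> \<in> phase_space \<gamma>"
      show "norm ((L n \<circ> proj_upto m) \<psi>) \<le> C * phase_norm \<gamma> \<psi>"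
        using order_trans[OF C(2)[OF proj_space[OF \<psi>]] mult_left_mono[OF proj_norm[OF \<psi>] C(1)]] by simp
    qed
    also have "\<dots> \<le> max M0 0 * phase_norm \<gamma> \<phi>"
      using M0[of n] phase_norm_nonneg[OF \<phi>] by (intro mult_right_mono) auto
    finally have tail: "norm (L n (proj_upto m \<phi>)) \<le> max M0 0 * phase_norm \<gamma> \<phi>" by simp
    have "\<phi> = (\<lambda>l. proj_upto m \<phi> l + (if l < K then \<phi> l else 0))"
      by (auto simp: proj fun_eq_iff)
    then have "L n \<phi> = L n (proj_upto m \<phi>) + L n (\<lambda>l. if l < K then \<phi> l else 0)"
      using L_add[OF proj_space[OF \<phi>] head_space[of K \<phi>], of n] by simp
    then show ?thesis
      using norm_triangle_mono[OF tail head[of K]] by (simp add: M_def distrib_right)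
  qed
  moreover have "0 \<le> M"
    using c by (auto simp: M_def intro!: add_nonneg_nonneg sum_nonneg)
  ultimately show ?thesis by blast
qed

section \<open>Weighted paths and uniform stability\<close>

text \<open>
  Truncated subtraction makes the weight \<open>S (j - \<tau>) = S 0 = 0\<close> for \<open>j \<le> \<tau>\<close>, and \<open>S (i - l) = 0\<close> on the
  coordinates \<open>l \<ge> i\<close> that stem from the initial tuple \<open>\<phi>\<close>.
\<close>

lemma weighted_path:
  fixes S :: "nat \<Rightarrow> real" and \<tau> :: nat and \<phi> :: "nat \<Rightarrow> 'a"
  assumes \<phi>: "\<phi> \<in> phase_space \<gamma>" and S0: "S 0 = 0"
  defines "Y \<equiv> hist L (\<lambda>_. 0) \<tau> \<phi>"
  defines "w \<equiv> \<lambda>j. S (j - \<tau>) *\<^sub>R Y (j - \<tau>) 0"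
  shows "w 0 = 0"
    and "j < \<tau> \<Longrightarrow> w (Suc j) - L j (padded w j) = 0"
    and "w (Suc (\<tau> + i)) - L (\<tau> + i) (padded w (\<tau> + i))
      = L (\<tau> + i) (\<lambda>l. (S (Suc i) - S (i - l)) *\<^sub>R Y i l)"
proof -
  show "w 0 = 0" by (simp add: w_def S0)
  show "w (Suc j) - L j (padded w j) = 0" if "j < \<tau>"
  proof -
    have "padded w j = (\<lambda>_. 0)" using that by (auto simp: padded_def w_def S0 fun_eq_iff)
    then show ?thesis using that by (simp add: w_def S0)
  qed
  have pad: "padded w (\<tau> + i) = (\<lambda>l. S (i - l) *\<^sub>R Y i l)"
  proof
    fix l
    have "Y (i - l) 0 = Y i l" if "l \<le> i"
      using hist_coord[of L "\<lambda>_. 0" \<tau> \<phi> i l] that by (simp add: Y_def)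
    then show "padded w (\<tau> + i) l = S (i - l) *\<^sub>R Y i l"
      by (cases "l \<le> i") (simp_all add: padded_def w_def S0)
  qed
  have Yi: "Y i \<in> phase_space \<gamma>" by (simp add: Y_def hist_phase_space \<phi>)
  have pad_space: "padded w (\<tau> + i) \<in> phase_space \<gamma>"
    by (rule phase_space_finite_support[of "\<tau> + i"]) (simp add: padded_def)
  \<comment> \<open>The homogeneous equation gives the next value; thus the forcing contains only
    differences of weights.\<close>
  have "w (Suc (\<tau> + i)) = S (Suc i) *\<^sub>R L (\<tau> + i) (Y i)"
    by (simp add: w_def Y_def Suc_diff_le)
  also have "\<dots> = L (\<tau> + i) (\<lambda>l. S (Suc i) *\<^sub>R Y i l)"
    using L_scale[OF Yi] by simp
  finally have "w (Suc (\<tau> + i)) - L (\<tau> + i) (padded w (\<tau> + i))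
      = L (\<tau> + i) (\<lambda>l. S (Suc i) *\<^sub>R Y i l - padded w (\<tau> + i) l)"
    using L_diff[OF phase_space_scale[OF Yi] pad_space, of "\<tau> + i" "S (Suc i)"] by simp
  then show "w (Suc (\<tau> + i)) - L (\<tau> + i) (padded w (\<tau> + i))
      = L (\<tau> + i) (\<lambda>l. (S (Suc i) - S (i - l)) *\<^sub>R Y i l)"
    by (simp add: pad scaleR_left_diff_distrib)
qed

text \<open>The solution is cut off up to and including \<tau>. The forcing at
  \<open>\<tau> + i\<close> then acts only on what remains of \<phi>, of size
  \<open>\<rho> ^ i\<close> times its norm, so its 1-norm is bounded by a geometric series.\<close>

lemma uniform_stability:
  assumes stable: "lp_lq_stable L p q" "1 \<le> p" "1 \<le> q"
    and M: "0 \<le> M" "\<And>n \<phi>. \<phi> \<in> phase_space \<gamma> \<Longrightarrow> norm (L n \<phi>) \<le> M * phase_norm \<gamma> \<phi>"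
  shows "\<exists>D\<ge>1. \<forall>\<tau> k. \<forall>\<phi>\<in>phase_space \<gamma>.
    phase_norm \<gamma> (hist L (\<lambda>_. 0) \<tau> \<phi> k) \<le> D * phase_norm \<gamma> \<phi>"
proof -
  obtain C where C: "0 < C" and path: "\<And>w J A n. w 0 = 0 \<Longrightarrow>
      (\<Sum>j<J. norm (w (Suc j) - L j (padded w j))) \<le> A \<Longrightarrow> n \<le> J \<Longrightarrow> norm (w n) \<le> C * A"
    by (rule path_bounds[OF stable]) (rule that)
  define \<rho> where "\<rho> = exp (- \<gamma>)"
  have \<rho>: "0 \<le> \<rho>" "\<rho> < 1" using gamma_pos by (simp_all add: \<rho>_def)
  define D where "D = max 1 (C * (M * (1 / (1 - \<rho>))))"
  have "phase_norm \<gamma> (hist L (\<lambda>_. 0) \<tau> \<phi> k) \<le> D * phase_norm \<gamma> \<phi>" if \<phi>: "\<phi> \<in> phase_space \<gamma>" for \<tau> k \<phi>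
  proof -
    define Y where "Y = hist L (\<lambda>_. 0) \<tau> \<phi>"
    define S :: "nat \<Rightarrow> real" where "S k = (if k = 0 then 0 else 1)" for k
    define w where "w = (\<lambda>j. S (j - \<tau>) *\<^sub>R Y (j - \<tau>) 0)"
    let ?f = "\<lambda>j. w (Suc j) - L j (padded w j)"
    have \<phi>0: "0 \<le> phase_norm \<gamma> \<phi>" by (rule phase_norm_nonneg[OF \<phi>])
    have wp: "w 0 = 0" "\<And>j. j < \<tau> \<Longrightarrow> ?f j = 0"
      "\<And>i. ?f (\<tau> + i) = L (\<tau> + i) (\<lambda>l. (S (Suc i) - S (i - l)) *\<^sub>R Y i l)"
      unfolding w_def Y_def by (intro weighted_path[OF \<phi>]; simp add: S_def)+
    have f: "norm (?f (\<tau> + i)) \<le> M * (\<rho> ^ i * phase_norm \<gamma> \<phi>)" for i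
    proof -
      let ?\<psi> = "\<lambda>l. (S (Suc i) - S (i - l)) *\<^sub>R Y i l"
      \<comment> \<open>The difference of weights is 0 for \<open>l < i\<close> and 1 on the
        coordinates inherited from \<phi>.\<close>
      have \<psi>: "norm (?\<psi> l) * exp (- \<gamma> * real l) \<le> \<rho> ^ i * phase_norm \<gamma> \<phi>" for l
      proof (cases "l < i")
        case True
        then show ?thesis using \<rho> \<phi>0 by (simp add: S_def)
      next
        case False
        then have "Y i l = \<phi> (l - i)"
          using hist_coord[of L "\<lambda>_. 0" \<tau> \<phi> i l] by (auto simp: Y_def)
        moreover have "exp (- \<gamma> * real l) = \<rho> ^ i * exp (- \<gamma> * real (l - i))"
          using False by (simp add: \<rho>_def of_nat_diff algebra_simps flip: exp_of_nat_mult exp_add)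
        ultimately have "norm (?\<psi> l) * exp (- \<gamma> * real l) = \<rho> ^ i * (norm (\<phi> (l - i)) * exp (- \<gamma> * real (l - i)))"
          using False by (simp add: S_def)
        then show ?thesis using \<rho> phase_coord_le[OF \<phi>] by (simp add: mult_left_mono)
      qed
      have "norm (?f (\<tau> + i)) \<le> M * phase_norm \<gamma> ?\<psi>"
        unfolding wp(3) by (rule M(2)) (rule phase_spaceI[OF \<psi>])
      also have "\<dots> \<le> M * (\<rho> ^ i * phase_norm \<gamma> \<phi>)"
        using M(1) by (intro mult_left_mono phase_norm_le \<psi>)
      finally show ?thesis .
    qed
    have "norm (Y k 0) \<le> D * phase_norm \<gamma> \<phi>" for k
    proof (cases "k = 0")
      case True
      have "norm (\<phi> 0) \<le> 1 * phase_norm \<gamma> \<phi>" using phase_norm_ge_head[OF \<phi>] by simp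
      also have "\<dots> \<le> D * phase_norm \<gamma> \<phi>" by (rule mult_right_mono[OF _ \<phi>0]) (simp add: D_def)
      finally show ?thesis using True by (simp add: Y_def)
    next
      case False
      have "(\<Sum>j<\<tau> + k. norm (?f j)) \<le> (\<Sum>i<k. M * (\<rho> ^ i * phase_norm \<gamma> \<phi>))"
      proof -
        have "(\<Sum>j<\<tau> + k. norm (?f j)) = (\<Sum>j\<in>{\<tau>..<\<tau> + k}. norm (?f j))"
          by (rule sum.mono_neutral_right) (use wp(2) in auto)
        also have "\<dots> = (\<Sum>i<k. norm (?f (\<tau> + i)))"
          using sum.shift_bounds_nat_ivl[of "\<lambda>j. norm (?f j)" 0 \<tau> k]
          by (simp add: atLeast0LessThan add.commute)
        also have "\<dots> \<le> (\<Sum>i<k. M * (\<rho> ^ i * phase_norm \<gamma> \<phi>))" by (rule sum_mono) (rule f)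
        finally show ?thesis .
      qed
      also have "\<dots> = M * ((\<Sum>i<k. \<rho> ^ i) * phase_norm \<gamma> \<phi>)"
        by (simp add: sum_distrib_left sum_distrib_right)
      also have "\<dots> \<le> M * (1 / (1 - \<rho>) * phase_norm \<gamma> \<phi>)"
        using M(1) \<phi>0 by (intro mult_left_mono mult_right_mono sum_gp_le \<rho>)
      finally have "norm (w (\<tau> + k)) \<le> C * (M * (1 / (1 - \<rho>) * phase_norm \<gamma> \<phi>))"
        using wp(1) by (intro path[where w = w and J = "\<tau> + k"]) simp_all
      also have "\<dots> \<le> D * phase_norm \<gamma> \<phi>"
        unfolding mult.assoc[symmetric] by (rule mult_right_mono[OF _ \<phi>0]) (simp add: D_def mult.assoc)
      finally show ?thesis using False by (simp add: w_def S_def)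
    qed
    moreover have "1 * phase_norm \<gamma> \<phi> \<le> D * phase_norm \<gamma> \<phi>"
      by (rule mult_right_mono[OF _ \<phi>0]) (simp add: D_def)
    ultimately show ?thesis
      using phase_norm_hist_le[OF \<phi>, of 0 "D * phase_norm \<gamma> \<phi>" "\<lambda>_. 0" \<tau> k] gamma_pos
      by (simp add: Y_def)
  qed
  then show ?thesis by (intro exI[of _ D]) (auto simp: D_def)
qed

section \<open>Decay of solutions\<close>

text \<open>With the weight \<open>real k\<close>, the differences of weights are at most
  \<open>Suc l\<close> at coordinate \<open>l\<close>; the phase weight absorbs this, so uniform
  stability makes the forcing bounded.\<close>

lemma weighted_sum_bound:
  assumes stable: "lp_lq_stable L p q" "1 \<le> p" "1 \<le> q"
    and M: "0 \<le> M" "\<And>n \<phi>. \<phi> \<in> phase_space \<gamma> \<Longrightarrow> norm (L n \<phi>) \<le> M * phase_norm \<gamma> \<phi>"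
  shows "\<exists>C\<ge>0. \<forall>\<tau> N. \<forall>\<phi>\<in>phase_space \<gamma>.
    (\<Sum>k<N. real (Suc k) * norm (hist L (\<lambda>_. 0) \<tau> \<phi> (Suc k) 0))
      \<le> C * real N powr (1 + enn2real (inverse p) - enn2real (inverse q)) * phase_norm \<gamma> \<phi>"
proof -
  let ?s = "1 + enn2real (inverse p) - enn2real (inverse q)"
  obtain C where C: "0 < C" and path: "\<And>w \<tau> N A. w 0 = 0 \<Longrightarrow>
      \<forall>j<\<tau>. w (Suc j) - L j (padded w j) = 0 \<Longrightarrow>
      \<forall>j. norm (w (Suc j) - L j (padded w j)) \<le> A \<Longrightarrow>
      (\<Sum>n\<in>{\<tau><..\<tau>+N}. norm (w n)) \<le> C * A * real N powr ?s"
    by (rule path_bounds[OF stable]) (rule that)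
  obtain D where D: "1 \<le> D" "\<And>\<tau> k \<phi>. \<phi> \<in> phase_space \<gamma> \<Longrightarrow>
      phase_norm \<gamma> (hist L (\<lambda>_. 0) \<tau> \<phi> k) \<le> D * phase_norm \<gamma> \<phi>"
    using uniform_stability[OF stable M] by blast
  define G where "G = 1 + 1 / \<gamma>"
  have "(\<Sum>k<N. real (Suc k) * norm (hist L (\<lambda>_. 0) \<tau> \<phi> (Suc k) 0))
      \<le> C * (M * (G * D)) * real N powr ?s * phase_norm \<gamma> \<phi>" if \<phi>: "\<phi> \<in> phase_space \<gamma>" for \<tau> N \<phi>
  proof -
    define Y where "Y = hist L (\<lambda>_. 0) \<tau> \<phi>"
    define w where "w = (\<lambda>j. real (j - \<tau>) *\<^sub>R Y (j - \<tau>) 0)"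
    let ?f = "\<lambda>j. w (Suc j) - L j (padded w j)"
    have \<phi>0: "0 \<le> phase_norm \<gamma> \<phi>" by (rule phase_norm_nonneg[OF \<phi>])
    have wp: "w 0 = 0" "\<And>j. j < \<tau> \<Longrightarrow> ?f j = 0"
      "\<And>i. ?f (\<tau> + i) = L (\<tau> + i) (\<lambda>l. (real (Suc i) - real (i - l)) *\<^sub>R Y i l)"
      unfolding w_def Y_def by (intro weighted_path[OF \<phi>]; simp)+
    have f: "norm (?f (\<tau> + i)) \<le> M * (G * D * phase_norm \<gamma> \<phi>)" for i
    proof -
      let ?\<psi> = "\<lambda>l. (real (Suc i) - real (i - l)) *\<^sub>R Y i l"
      have \<psi>: "norm (?\<psi> l) * exp (- \<gamma> * real l) \<le> G * D * phase_norm \<gamma> \<phi>" for l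
      proof -
        \<comment> \<open>Going back \<open>m\<close> steps reaches the history
          \<open>Y (i - m)\<close>. The phase weight splits accordingly: one factor absorbs
          \<open>Suc m\<close>, the other belongs to the norm of that earlier history.\<close>
        define m where "m = min l i"
        have coeff: "real (Suc i) - real (i - l) = real (Suc m)"
          by (auto simp: m_def min_def of_nat_diff)
        have coord: "Y i l = Y (i - m) (l - m)"
          using hist_coord[of L "\<lambda>_. 0" \<tau> \<phi> i l] by (auto simp: Y_def m_def min_def)
        have e: "exp (- \<gamma> * real l) = exp (- \<gamma> * real m) * exp (- \<gamma> * real (l - m))"
          by (simp add: m_def of_nat_diff algebra_simps flip: exp_add)
        have "norm (?\<psi> l) * exp (- \<gamma> * real l)
            = (real (Suc m) * exp (- \<gamma> * real m)) * (norm (Y (i - m) (l - m)) * exp (- \<gamma> * real (l - m)))"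
          unfolding coeff coord e by simp
        also have "\<dots> \<le> G * (D * phase_norm \<gamma> \<phi>)"
        proof (rule mult_mono)
          show "real (Suc m) * exp (- \<gamma> * real m) \<le> G"
            unfolding G_def by (rule Suc_mult_exp_le[OF gamma_pos])
          show "norm (Y (i - m) (l - m)) * exp (- \<gamma> * real (l - m)) \<le> D * phase_norm \<gamma> \<phi>"
            using order_trans[OF phase_coord_le[OF hist_phase_space[OF \<phi>]] D(2)[OF \<phi>]]
            unfolding Y_def .
        qed (use gamma_pos in \<open>simp_all add: G_def\<close>)
        finally show ?thesis by (simp only: mult.assoc)
      qed
      have "norm (?f (\<tau> + i)) \<le> M * phase_norm \<gamma> ?\<psi>"
        unfolding wp(3) by (rule M(2)) (rule phase_spaceI[OF \<psi>])
      also have "\<dots> \<le> M * (G * D * phase_norm \<gamma> \<phi>)"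
        using M(1) by (intro mult_left_mono phase_norm_le \<psi>)
      finally show ?thesis .
    qed
    have "norm (?f j) \<le> M * (G * D * phase_norm \<gamma> \<phi>)" for j
    proof (cases "j < \<tau>")
      case True
      then have "?f j = 0" by (rule wp)
      moreover have "0 \<le> M * (G * D * phase_norm \<gamma> \<phi>)" using order_trans[OF norm_ge_zero f] .
      ultimately show ?thesis by simp
    next
      case False
      then show ?thesis using f[of "j - \<tau>"] by simp
    qed
    then have "(\<Sum>n\<in>{\<tau><..\<tau>+N}. norm (w n)) \<le> C * (M * (G * D * phase_norm \<gamma> \<phi>)) * real N powr ?s"
      using wp(1,2) by (intro path[where w = w]) auto
    moreover have "(\<Sum>n\<in>{\<tau><..\<tau>+N}. norm (w n)) = (\<Sum>k<N. real (Suc k) * norm (Y (Suc k) 0))"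
    proof (rule sum.reindex_bij_witness[of _ "\<lambda>k. \<tau> + Suc k" "\<lambda>n. n - Suc \<tau>"])
      fix n assume n: "n \<in> {\<tau><..\<tau> + N}"
      then have "n - \<tau> = Suc (n - Suc \<tau>)" by auto
      then show "real (Suc (n - Suc \<tau>)) * norm (Y (Suc (n - Suc \<tau>)) 0) = norm (w n)"
        by (simp add: w_def)
    qed auto
    ultimately show ?thesis by (simp only: Y_def mult_ac)
  qed
  moreover have "0 \<le> C * (M * (G * D))"
    using C M(1) D(1) gamma_pos by (simp add: G_def)
  ultimately show ?thesis by blast
qed

text \<open>The weighted sum \<open>Z\<close> of history norms is of order \<open>N powr ?s\<close>,
  while uniform stability bounds it below by a multiple of \<open>N ^ 2\<close> times the norm at
  \<open>N\<close>. As \<open>?s < 2\<close>, the norm is halved after a fixed time, and iteration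
  gives exponential decay.\<close>

lemma stable_imp_ues_phase:
  assumes stable: "lp_lq_stable L p q" and pq: "1 \<le> p" "p \<le> q" "(p, q) \<noteq> (1, \<infinity>)"
    and m: "bdd_above (range (\<lambda>n. operator_norm \<gamma> (L n \<circ> proj_upto m)))"
  shows "ues_phase \<gamma> L"
proof -
  have q: "1 \<le> q" using pq by simp
  let ?s = "1 + enn2real (inverse p) - enn2real (inverse q)"
  have s: "1 \<le> ?s" "?s < 2" using enn2real_inverse_exponents[OF pq] by auto
  obtain M where M: "0 \<le> M" "\<And>n \<phi>. \<phi> \<in> phase_space \<gamma> \<Longrightarrow> norm (L n \<phi>) \<le> M * phase_norm \<gamma> \<phi>"
    using uniformly_bounded_operators[OF stable pq(1) q m] by blast
  obtain D where D: "1 \<le> D" and D_le: "\<And>\<tau> k \<phi>. \<phi> \<in> phase_space \<gamma> \<Longrightarrow>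
      phase_norm \<gamma> (hist L (\<lambda>_. 0) \<tau> \<phi> k) \<le> D * phase_norm \<gamma> \<phi>"
    using uniform_stability[OF stable pq(1) q M] by blast
  obtain C where C: "0 \<le> C" and C_le: "\<And>\<tau> N \<phi>. \<phi> \<in> phase_space \<gamma> \<Longrightarrow>
      (\<Sum>k<N. real (Suc k) * norm (hist L (\<lambda>_. 0) \<tau> \<phi> (Suc k) 0))
        \<le> C * real N powr ?s * phase_norm \<gamma> \<phi>"
    using weighted_sum_bound[OF stable pq(1) q M] by blast
  define \<rho> where "\<rho> = exp (- \<gamma>)"
  have \<rho>: "0 \<le> \<rho>" "\<rho> < 1" using gamma_pos by (simp_all add: \<rho>_def)
  define c where "c = 2 * D * (C + D) / (1 - \<rho>)"
  have decay: "phase_norm \<gamma> (hist L (\<lambda>_. 0) \<tau> \<phi> N) \<le> c * real N powr (?s - 2) * phase_norm \<gamma> \<phi>"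
    if \<phi>: "\<phi> \<in> phase_space \<gamma>" and N: "1 \<le> N" for \<tau> N \<phi>
  proof -
    define \<Phi> where "\<Phi> k = phase_norm \<gamma> (hist L (\<lambda>_. 0) \<tau> \<phi> k)" for k
    let ?y = "\<lambda>k. norm (hist L (\<lambda>_. 0) \<tau> \<phi> k 0)"
    define Z where "Z = (\<Sum>k<N. real (Suc k) * \<Phi> (Suc k))"
    have \<phi>0: "0 \<le> phase_norm \<gamma> \<phi>" by (rule phase_norm_nonneg[OF \<phi>])
    have \<Phi>0: "0 \<le> \<Phi> k" for k
      unfolding \<Phi>_def by (intro phase_norm_nonneg hist_phase_space \<phi>)
    have \<Phi>D: "\<Phi> k \<le> D * phase_norm \<gamma> \<phi>" for k
      unfolding \<Phi>_def by (rule D_le[OF \<phi>])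
    \<comment> \<open>The weight of the contracted old history is split as \<open>k + 1\<close>, so
      that its weighted part reproduces \<open>Z\<close>.\<close>
    have "real (Suc k) * \<Phi> (Suc k) \<le> real (Suc k) * ?y (Suc k) + \<rho> * (real k * \<Phi> k + \<Phi> k)" for k
    proof -
      have "\<Phi> (Suc k) \<le> ?y (Suc k) + \<rho> * \<Phi> k"
        using phase_norm_hist_Suc[OF \<phi>, of "\<lambda>_. 0" \<tau> k] mult_nonneg_nonneg[OF \<rho>(1) \<Phi>0[of k]]
          norm_ge_zero[of "hist L (\<lambda>_. 0) \<tau> \<phi> (Suc k) 0"]
        unfolding \<Phi>_def \<rho>_def by linarith
      then have "real (Suc k) * \<Phi> (Suc k) \<le> real (Suc k) * (?y (Suc k) + \<rho> * \<Phi> k)"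
        by (rule mult_left_mono) simp
      then show ?thesis by (simp add: algebra_simps)
    qed
    then have "Z \<le> (\<Sum>k<N. real (Suc k) * ?y (Suc k) + \<rho> * (real k * \<Phi> k + \<Phi> k))"
      unfolding Z_def by (rule sum_mono)
    also have "\<dots> = (\<Sum>k<N. real (Suc k) * ?y (Suc k))
        + \<rho> * ((\<Sum>k<N. real k * \<Phi> k) + (\<Sum>k<N. \<Phi> k))"
      by (simp only: sum.distrib sum_distrib_left[symmetric])
    \<comment> \<open>The term \<open>\<rho> * Z\<close> is absorbed on the left afterwards. The
      unweighted sum costs a factor \<open>N\<close>, which \<open>N powr ?s\<close> dominates
      because \<open>1 \<le> ?s\<close>.\<close>
    also have "\<dots> \<le> C * real N powr ?s * phase_norm \<gamma> \<phi> + (\<rho> * Z + real N * (D * phase_norm \<gamma> \<phi>))"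
    proof (rule add_mono[OF C_le[OF \<phi>]])
      have "(\<Sum>k<N. real k * \<Phi> k) \<le> (\<Sum>k<Suc N. real k * \<Phi> k)" using \<Phi>0 by simp
      also have "\<dots> = Z" unfolding Z_def by (simp add: sum.lessThan_Suc_shift del: sum.lessThan_Suc)
      finally have "\<rho> * (\<Sum>k<N. real k * \<Phi> k) \<le> \<rho> * Z" by (rule mult_left_mono[OF _ \<rho>(1)])
      moreover have "\<rho> * (\<Sum>k<N. \<Phi> k) \<le> 1 * (real N * (D * phase_norm \<gamma> \<phi>))"
        using \<rho> sum_bounded_above[of "{..<N}" \<Phi>, OF \<Phi>D] sum_nonneg[of "{..<N}" \<Phi>, OF \<Phi>0]
        by (intro mult_mono) auto
      ultimately show "\<rho> * ((\<Sum>k<N. real k * \<Phi> k) + (\<Sum>k<N. \<Phi> k)) \<le> \<rho> * Z + real N * (D * phase_norm \<gamma> \<phi>)"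
        by (simp add: distrib_left)
    qed
    also have "real N * (D * phase_norm \<gamma> \<phi>) \<le> real N powr ?s * (D * phase_norm \<gamma> \<phi>)"
    proof (rule mult_right_mono)
      show "real N \<le> real N powr ?s" using powr_mono[OF s(1), of "real N"] N by simp
    qed (use D \<phi>0 in simp)
    finally have Z_le: "(1 - \<rho>) * Z \<le> (C + D) * real N powr ?s * phase_norm \<gamma> \<phi>"
      by (simp add: algebra_simps)
    \<comment> \<open>Restarting at \<open>Suc k\<close> and applying uniform stability from
      there.\<close>
    have \<Phi>N: "\<Phi> N \<le> D * \<Phi> (Suc k)" if "k < N" for k
    proof -
      have "hist L (\<lambda>_. 0) \<tau> \<phi> N = hist L (\<lambda>_. 0) (\<tau> + Suc k) (hist L (\<lambda>_. 0) \<tau> \<phi> (Suc k)) (N - Suc k)"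
        using hist_add[of L "\<lambda>_. 0" \<tau> \<phi> "Suc k" "N - Suc k"] that by (simp del: hist.simps)
      then show ?thesis
        unfolding \<Phi>_def using D_le[OF hist_phase_space[OF \<phi>]] by (simp del: hist.simps)
    qed
    have "real N ^ 2 \<le> 2 * (\<Sum>k<N. real (Suc k))"
      by (induction N) (simp_all add: power2_eq_square algebra_simps)
    then have "real N ^ 2 * \<Phi> N \<le> 2 * (\<Sum>k<N. real (Suc k)) * \<Phi> N"
      by (rule mult_right_mono[OF _ \<Phi>0])
    also have "\<dots> = 2 * (\<Sum>k<N. real (Suc k) * \<Phi> N)"
      by (simp add: sum_distrib_right)
    also have "(\<Sum>k<N. real (Suc k) * \<Phi> N) \<le> (\<Sum>k<N. real (Suc k) * (D * \<Phi> (Suc k)))"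
      by (intro sum_mono mult_left_mono \<Phi>N) auto
    also have "\<dots> = D * Z"
      unfolding Z_def sum_distrib_left by (rule sum.cong) auto
    finally have "real N ^ 2 * \<Phi> N \<le> 2 * D * Z" by simp
    then have "(1 - \<rho>) * (real N ^ 2 * \<Phi> N) \<le> (1 - \<rho>) * (2 * D * Z)"
      using \<rho> by (intro mult_left_mono) auto
    also have "\<dots> = 2 * D * ((1 - \<rho>) * Z)" by simp
    also have "\<dots> \<le> 2 * D * ((C + D) * real N powr ?s * phase_norm \<gamma> \<phi>)"
      using D by (intro mult_left_mono Z_le) auto
    finally have "(1 - \<rho>) * (real N ^ 2 * \<Phi> N) \<le> 2 * D * ((C + D) * real N powr ?s * phase_norm \<gamma> \<phi>)" .
    moreover have "0 < (1 - \<rho>) * real N ^ 2" using \<rho> N by simp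
    ultimately have "\<Phi> N \<le> 2 * D * ((C + D) * real N powr ?s * phase_norm \<gamma> \<phi>) / ((1 - \<rho>) * real N ^ 2)"
      by (simp only: pos_le_divide_eq mult_ac)
    also have "\<dots> = c * (real N powr ?s / real N ^ 2) * phase_norm \<gamma> \<phi>"
      by (simp add: c_def)
    also have "real N powr ?s / real N ^ 2 = real N powr (?s - 2)"
      unfolding powr_diff using N by simp
    finally show ?thesis by (simp only: \<Phi>_def)
  qed
  have "(\<lambda>N. c * real N powr (?s - 2)) \<longlonglongrightarrow> c * 0"
    using s by (intro tendsto_mult tendsto_const tendsto_neg_powr filterlim_real_sequentially) auto
  then have "\<forall>\<^sub>F N in sequentially. c * real N powr (?s - 2) < 1 / 2"
    by (rule order_tendstoD) simp
  then obtain N where N: "1 \<le> N" "c * real N powr (?s - 2) < 1 / 2"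
    using eventually_happens[OF eventually_conj[OF eventually_ge_at_top[of "1::nat"]]] by fastforce
  have halve: "phase_norm \<gamma> (hist L (\<lambda>_. 0) \<tau> \<phi> N) \<le> 1 / 2 * phase_norm \<gamma> \<phi>"
    if \<phi>: "\<phi> \<in> phase_space \<gamma>" for \<tau> \<phi>
    using order_trans[OF decay[OF \<phi> N(1)] mult_right_mono[OF less_imp_le[OF N(2)] phase_norm_nonneg[OF \<phi>]]] .
  have halves: "phase_norm \<gamma> (hist L (\<lambda>_. 0) \<tau> \<phi> (j * N)) \<le> (1 / 2) ^ j * phase_norm \<gamma> \<phi>"
    if \<phi>: "\<phi> \<in> phase_space \<gamma>" for \<tau> \<phi> j
  proof (induction j)
    case (Suc j)
    have "phase_norm \<gamma> (hist L (\<lambda>_. 0) \<tau> \<phi> (j * N + N)) \<le> 1 / 2 * phase_norm \<gamma> (hist L (\<lambda>_. 0) \<tau> \<phi> (j * N))"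
      unfolding hist_add by (rule halve[OF hist_phase_space[OF \<phi>]])
    then show ?case using Suc by (simp add: add.commute)
  qed simp
  define \<nu> where "\<nu> = ln 2 / real N"
  have "phase_norm \<gamma> (hist L (\<lambda>_. 0) \<tau> \<phi> k) \<le> (2 * D) * exp (- \<nu> * real k) * phase_norm \<gamma> \<phi>"
    if \<phi>: "\<phi> \<in> phase_space \<gamma>" for \<tau> \<phi> k
  proof -
    define j where "j = k div N"
    have k: "k = j * N + k mod N" by (simp add: j_def)
    have "phase_norm \<gamma> (hist L (\<lambda>_. 0) \<tau> \<phi> (j * N + k mod N)) \<le> D * phase_norm \<gamma> (hist L (\<lambda>_. 0) \<tau> \<phi> (j * N))"
      unfolding hist_add by (rule D_le[OF hist_phase_space[OF \<phi>]])
    also have "\<dots> \<le> D * ((1 / 2) ^ j * phase_norm \<gamma> \<phi>)"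
      using D by (intro mult_left_mono halves[OF \<phi>]) auto
    \<comment> \<open>Rounding \<open>k / N\<close> down to \<open>j\<close> loses less than one
      halving, hence the factor 2.\<close>
    also have "(1 / 2) ^ j \<le> 2 * exp (- \<nu> * real k)"
    proof -
      have "k < (Suc j) * N" using k N mod_less_divisor[of N k] by (simp only: mult_Suc) linarith
      then have "real k \<le> real (Suc j) * real N" by (metis less_imp_le of_nat_le_iff of_nat_mult)
      then have "\<nu> * real k \<le> real (Suc j) * ln 2"
        using N mult_right_mono[of "real k" "real (Suc j) * real N" "ln 2"]
        by (simp add: \<nu>_def divide_le_eq mult_ac)
      then have "exp (- (real (Suc j) * ln 2)) \<le> exp (- \<nu> * real k)" by simp
      moreover have "exp (- (real (Suc j) * ln 2)) = (1 / 2) ^ Suc j"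
        by (simp add: exp_minus exp_of_nat_mult power_one_over inverse_eq_divide del: of_nat_Suc)
      moreover have "(1 / 2 :: real) ^ j = 2 * (1 / 2) ^ Suc j" by simp
      ultimately show ?thesis by linarith
    qed
    finally show ?thesis
      using D k by (simp add: mult_left_mono mult_right_mono phase_norm_nonneg[OF \<phi>])
  qed
  moreover have "1 \<le> 2 * D" "0 < \<nu>" using D N by (simp_all add: \<nu>_def)
  ultimately show ?thesis
    unfolding ues_phase_hist by blast
qed

end

theorem theorem3p1:
  fixes \<gamma> :: real
    and L :: "nat \<Rightarrow> (nat \<Rightarrow> 'a::banach) \<Rightarrow> 'a"
    and p q :: ennreal
  assumes "\<gamma> > 0"
    and "\<And>n. L n \<in> bounded_operators \<gamma>"
    and "1 \<le> p" and "p \<le> q" and "(p, q) \<noteq> (1, \<infinity>)"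
  shows "(ues_state \<gamma> L \<longleftrightarrow> ues_phase \<gamma> L) \<and>
         (ues_phase \<gamma> L \<longleftrightarrow>
            lp_lq_stable L p q \<and>
            (\<exists>m::int\<le>0. bdd_above (range (\<lambda>n. operator_norm \<gamma> (L n \<circ> proj_upto m)))))"
proof -
  interpret delay_system \<gamma> L
    using assms(1,2) by unfold_locales
  \<comment> \<open>The forward direction supplies \<open>m = 0\<close>; the converse accepts any
    \<open>m\<close>.\<close>
  show ?thesis
    using ues_state_iff_ues_phase ues_phase_imp_stable[OF _ assms(3,4)]
      stable_imp_ues_phase[OF _ assms(3-5)] by blast
qed

end
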